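(* Let $(\hat M^{2n},\hat g,J)$ be an almost Hermitian manifold and $f\colon\hat M\to\mathbb R$ a strictly positive smooth function, and equip the warped product $M=\hat M\times_f\mathbb R$ with its induced almost contact metric structure. Then the Reeb field $\xi$ is harmonic, i.e. $\tau(\xi)=0$, and the first harmonic section equation $\tau(\xi)+\tfrac12J\,T(\phi)=0$ is verified.
   Context: An almost contact metric structure on a Riemannian manifold $(M^{2n+1},g)$ consists of a $(1,1)$-tensor $\phi$, a unit vector field $\xi$ (the Reeb field) and its dual $1$-form $\eta=g(\xi,\cdot)$, with $\phi^2=-I+\eta\otimes\xi$ and $g(\phi X,\phi Y)=g(X,Y)-\eta(X)\eta(Y)$. Everything is smooth. $\nabla$ is the Levi-Civita connection; $\mathcal{D}=\operatorname{im}\phi=\ker\eta$; $J=\phi|_{\mathcal D}$; $\bar\nabla$ is the connection in $\mathcal{D}\to M$ given by $\bar\nabla_XY=(\nabla_XY)_{\mathcal D}$ (orthogonal projection), $X\in TM$, $Y$ a section of $\mathcal D$. $\nabla^2_{X,Y}=\nabla_X\nabla_Y-\nabla_{\nabla_XY}$. For a local orthonormal frame $(E_i)$ of $TM$ (sums over repeated indices): $\nabla^*\nabla\xi=-\nabla^2_{E_i,E_i}\xi$, $$\tau(\xi)=\nabla^*\nabla\xi-|\nabla\xi|^2\xi,\qquad T(\phi)=(\bar\nabla_{E_i}J)\big(\nabla_{E_i}\xi\big)$$ (note that $\nabla_X\xi\in\mathcal D$). The unit vector field $\xi$ is harmonic if $\tau(\xi)=0$. The warped product $\hat M\times_f\mathbb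 R$ is $\hat M\times\mathbb R$ with metric $g=\hat g+f^2dt^2$. Its induced almost contact metric structure is given by $\xi=f^{-1}\partial_t$, $\mathcal D=T\hat M$ equipped with the almost Hermitian structure $J$ of $\hat M$ (so $\phi\xi=0$ and $\phi|_{\mathcal D}=J$). *)

theory Defs
  imports "HOL-Analysis.Analysis"
begin

section \<open>Smooth functions on open subsets of Euclidean space\<close>

primrec Ck_on :: "nat \<Rightarrow> 'a::euclidean_space set \<Rightarrow> ('a \<Rightarrow> 'b::euclidean_space) \<Rightarrow> bool" where
  "Ck_on 0 S f \<longleftrightarrow> continuous_on S f"
| "Ck_on (Suc k) S f \<longleftrightarrow> (\<forall>x\<in>S. f differentiable (at x)) \<and>
     (\<forall>v. Ck_on k S (\<lambda>x. frechet_derivative f (at x) v))"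

text \<open>Only used for open \<open>S\<close>.\<close>

definition smooth_on :: "'a::euclidean_space set \<Rightarrow> ('a \<Rightarrow> 'b::euclidean_space) \<Rightarrow> bool" where
  "smooth_on S f \<longleftrightarrow> (\<forall>k. Ck_on k S f)"

section \<open>Smooth manifolds\<close>

text \<open>
  A manifold is a whole (Hausdorff, second countable) type \<open>'m\<close> with an atlas of charts into
  the Euclidean space \<open>'e\<close>.  The atlas need not be maximal.  Each point has a preferred chart
  in the atlas, through which the tangent space at that point is identified with \<open>'e\<close>: a
  tangent vector at \<open>p\<close> is given by its components in \<open>chart_at M p\<close>.  Hence vector fields are
  functions \<open>'m \<Rightarrow> 'e\<close>, and a local vector field on an open set \<open>U\<close> is such a function of which
  only the values on \<open>U\<close> matter.  Preferred charts may jump from point to point, so smoothness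
  of a field is not smoothness of this function; see \<open>smooth_vf\<close>.
\<close>

record ('m, 'e) chart =
  cdom :: "'m set"
  cmap :: "'m \<Rightarrow> 'e"

definition cinv :: "('m, 'e) chart \<Rightarrow> 'e \<Rightarrow> 'm" where
  "cinv c = inv_into (cdom c) (cmap c)"

definition is_chart :: "('m::topological_space, 'e::euclidean_space) chart \<Rightarrow> bool" where
  "is_chart c \<longleftrightarrow> open (cdom c) \<and> open (cmap c ` cdom c) \<and>
     homeomorphism (cdom c) (cmap c ` cdom c) (cmap c) (cinv c)"

record ('m, 'e) manifold =
  atlas :: "('m, 'e) chart set"
  chart_at :: "'m \<Rightarrow> ('m, 'e) chart"

definition smooth_manifold ::
    "('m::{t2_space, second_countable_topology}, 'e::euclidean_space) manifold \<Rightarrow> bool" where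
  "smooth_manifold M \<longleftrightarrow>
     (\<forall>c\<in>atlas M. is_chart c) \<and>
     (\<forall>c\<in>atlas M. \<forall>d\<in>atlas M. smooth_on (cmap c ` (cdom c \<inter> cdom d)) (cmap d \<circ> cinv c)) \<and>
     (\<forall>p. chart_at M p \<in> atlas M \<and> p \<in> cdom (chart_at M p))"

definition smooth_fun ::
    "('m, 'e::euclidean_space) manifold \<Rightarrow> 'm set \<Rightarrow> ('m \<Rightarrow> real) \<Rightarrow> bool" where
  "smooth_fun M U h \<longleftrightarrow> (\<forall>c\<in>atlas M. smooth_on (cmap c ` (U \<inter> cdom c)) (h \<circ> cinv c))"

text \<open>Components in the chart \<open>c\<close> of the tangent vector \<open>v\<close> at \<open>p\<close>.\<close>

definition components ::
    "('m, 'e::euclidean_space) manifold \<Rightarrow> ('m, 'e) chart \<Rightarrow> 'm \<Rightarrow> 'e \<Rightarrow> 'e" where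
  "components M c p v =
     frechet_derivative (cmap c \<circ> cinv (chart_at M p)) (at (cmap (chart_at M p) p)) v"

definition smooth_vf ::
    "('m, 'e::euclidean_space) manifold \<Rightarrow> 'm set \<Rightarrow> ('m \<Rightarrow> 'e) \<Rightarrow> bool" where
  "smooth_vf M U X \<longleftrightarrow>
     (\<forall>c\<in>atlas M. smooth_on (cmap c ` (U \<inter> cdom c))
        (\<lambda>x. components M c (cinv c x) (X (cinv c x))))"

text \<open>The derivative \<open>X h\<close> of a function \<open>h\<close> along a vector field \<open>X\<close>.\<close>

definition dir_deriv ::
    "('m, 'e::euclidean_space) manifold \<Rightarrow> ('m \<Rightarrow> 'e) \<Rightarrow> ('m \<Rightarrow> real) \<Rightarrow> 'm \<Rightarrow> real" where
  "dir_deriv M X h p =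
     frechet_derivative (h \<circ> cinv (chart_at M p)) (at (cmap (chart_at M p) p)) (X p)"

section \<open>Riemannian and almost Hermitian manifolds\<close>

definition riemannian_metric ::
    "('m::topological_space, 'e::euclidean_space) manifold \<Rightarrow> ('m \<Rightarrow> 'e \<Rightarrow> 'e \<Rightarrow> real) \<Rightarrow> bool" where
  "riemannian_metric M g \<longleftrightarrow>
     (\<forall>p. bilinear (g p)) \<and>
     (\<forall>p v w. g p v w = g p w v) \<and>
     (\<forall>p v. v \<noteq> 0 \<longrightarrow> g p v v > 0) \<and>
     (\<forall>U X Y. open U \<longrightarrow> smooth_vf M U X \<longrightarrow> smooth_vf M U Y \<longrightarrow>
        smooth_fun M U (\<lambda>p. g p (X p) (Y p)))"

definition smooth_endomorphism ::
    "('m::topological_space, 'e::euclidean_space) manifold \<Rightarrow> ('m \<Rightarrow> 'e \<Rightarrow> 'e) \<Rightarrow> bool" where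
  "smooth_endomorphism M A \<longleftrightarrow>
     (\<forall>p. linear (A p)) \<and>
     (\<forall>U X. open U \<longrightarrow> smooth_vf M U X \<longrightarrow> smooth_vf M U (\<lambda>p. A p (X p)))"

definition almost_hermitian ::
    "('m::{t2_space, second_countable_topology}, 'e::euclidean_space) manifold \<Rightarrow>
     ('m \<Rightarrow> 'e \<Rightarrow> 'e \<Rightarrow> real) \<Rightarrow> ('m \<Rightarrow> 'e \<Rightarrow> 'e) \<Rightarrow> bool" where
  "almost_hermitian M g J \<longleftrightarrow>
     smooth_manifold M \<and> riemannian_metric M g \<and> smooth_endomorphism M J \<and>
     (\<forall>p v. J p (J p v) = - v) \<and>
     (\<forall>p v w. g p (J p v) (J p w) = g p v w)"

section \<open>The Levi-Civita connection\<close>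

text \<open>
  A connection acts on local vector fields.  Since the axioms are imposed on every open set \<open>U\<close>,
  the values of \<open>\<nabla>\<^sub>X Y\<close> on \<open>U\<close> depend only on the restrictions of \<open>X\<close> and \<open>Y\<close> to \<open>U\<close>; the
  values at points near which \<open>X\<close> or \<open>Y\<close> is not smooth are irrelevant.
\<close>

type_synonym ('m, 'e) connection = "('m \<Rightarrow> 'e) \<Rightarrow> ('m \<Rightarrow> 'e) \<Rightarrow> 'm \<Rightarrow> 'e"

definition affine_connection ::
    "('m::topological_space, 'e::euclidean_space) manifold \<Rightarrow> ('m, 'e) connection \<Rightarrow> bool" where
  "affine_connection M nabla \<longleftrightarrow>
     (\<forall>U X Y. open U \<longrightarrow> smooth_vf M U X \<longrightarrow> smooth_vf M U Y \<longrightarrow>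
        smooth_vf M U (nabla X Y)) \<and>
     (\<forall>U X X' Y. open U \<longrightarrow> smooth_vf M U X \<longrightarrow> smooth_vf M U X' \<longrightarrow> smooth_vf M U Y \<longrightarrow>
        (\<forall>p\<in>U. nabla (\<lambda>q. X q + X' q) Y p = nabla X Y p + nabla X' Y p)) \<and>
     (\<forall>U h X Y. open U \<longrightarrow> smooth_fun M U h \<longrightarrow> smooth_vf M U X \<longrightarrow> smooth_vf M U Y \<longrightarrow>
        (\<forall>p\<in>U. nabla (\<lambda>q. h q *\<^sub>R X q) Y p = h p *\<^sub>R nabla X Y p)) \<and>
     (\<forall>U X Y Y'. open U \<longrightarrow> smooth_vf M U X \<longrightarrow> smooth_vf M U Y \<longrightarrow> smooth_vf M U Y' \<longrightarrow>
        (\<forall>p\<in>U. nabla X (\<lambda>q. Y q + Y' q) p = nabla X Y p + nabla X Y' p)) \<and>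
     (\<forall>U h X Y. open U \<longrightarrow> smooth_fun M U h \<longrightarrow> smooth_vf M U X \<longrightarrow> smooth_vf M U Y \<longrightarrow>
        (\<forall>p\<in>U. nabla X (\<lambda>q. h q *\<^sub>R Y q) p
               = dir_deriv M X h p *\<^sub>R Y p + h p *\<^sub>R nabla X Y p))"

text \<open>
  Vanishing torsion, \<open>\<nabla>\<^sub>X Y - \<nabla>\<^sub>Y X = [X, Y]\<close>, where \<open>[X, Y] h = X (Y h) - Y (X h)\<close> for all
  smooth functions \<open>h\<close>.
\<close>

definition torsion_free ::
    "('m::topological_space, 'e::euclidean_space) manifold \<Rightarrow> ('m, 'e) connection \<Rightarrow> bool" where
  "torsion_free M nabla \<longleftrightarrow>
     (\<forall>U X Y h. open U \<longrightarrow> smooth_vf M U X \<longrightarrow> smooth_vf M U Y \<longrightarrow> smooth_fun M U h \<longrightarrow>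
        (\<forall>p\<in>U. dir_deriv M (\<lambda>q. nabla X Y q - nabla Y X q) h p
               = dir_deriv M X (dir_deriv M Y h) p - dir_deriv M Y (dir_deriv M X h) p))"

definition metric_connection ::
    "('m::topological_space, 'e::euclidean_space) manifold \<Rightarrow> ('m \<Rightarrow> 'e \<Rightarrow> 'e \<Rightarrow> real) \<Rightarrow>
     ('m, 'e) connection \<Rightarrow> bool" where
  "metric_connection M g nabla \<longleftrightarrow>
     (\<forall>U X Y Z. open U \<longrightarrow> smooth_vf M U X \<longrightarrow> smooth_vf M U Y \<longrightarrow> smooth_vf M U Z \<longrightarrow>
        (\<forall>p\<in>U. dir_deriv M X (\<lambda>q. g q (Y q) (Z q)) p
               = g p (nabla X Y p) (Z p) + g p (Y p) (nabla X Z p)))"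

definition levi_civita ::
    "('m::topological_space, 'e::euclidean_space) manifold \<Rightarrow> ('m \<Rightarrow> 'e \<Rightarrow> 'e \<Rightarrow> real) \<Rightarrow>
     ('m, 'e) connection \<Rightarrow> bool" where
  "levi_civita M g nabla \<longleftrightarrow>
     affine_connection M nabla \<and> torsion_free M nabla \<and> metric_connection M g nabla"

section \<open>Harmonic unit fields and the first harmonic section equation\<close>

definition orthonormal_frame ::
    "('m::topological_space, 'e::euclidean_space) manifold \<Rightarrow> ('m \<Rightarrow> 'e \<Rightarrow> 'e \<Rightarrow> real) \<Rightarrow>
     'm set \<Rightarrow> (nat \<Rightarrow> 'm \<Rightarrow> 'e) \<Rightarrow> bool" where
  "orthonormal_frame M g U E \<longleftrightarrow>
     open U \<and> (\<forall>i<DIM('e). smooth_vf M U (E i)) \<and>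
     (\<forall>p\<in>U. \<forall>i<DIM('e). \<forall>j<DIM('e). g p (E i p) (E j p) = (if i = j then 1 else 0))"

definition nabla2 ::
    "('m, 'e::euclidean_space) connection \<Rightarrow> ('m \<Rightarrow> 'e) \<Rightarrow> ('m \<Rightarrow> 'e) \<Rightarrow> ('m \<Rightarrow> 'e) \<Rightarrow> 'm \<Rightarrow> 'e" where
  "nabla2 nabla X Y V p = nabla X (nabla Y V) p - nabla (nabla X Y) V p"

text \<open>
  The following expressions are evaluated in a given local orthonormal frame \<open>E\<close>, at points
  of its domain.  They do not depend on the frame; equations between them are required to hold
  in every local orthonormal frame.
\<close>

definition rough_laplacian ::
    "('m, 'e::euclidean_space) connection \<Rightarrow> (nat \<Rightarrow> 'm \<Rightarrow> 'e) \<Rightarrow> ('m \<Rightarrow> 'e) \<Rightarrow> 'm \<Rightarrow> 'e" where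
  "rough_laplacian nabla E V p = - (\<Sum>i<DIM('e). nabla2 nabla (E i) (E i) V p)"

definition norm2_nabla ::
    "('m \<Rightarrow> 'e \<Rightarrow> 'e \<Rightarrow> real) \<Rightarrow> ('m, 'e::euclidean_space) connection \<Rightarrow>
     (nat \<Rightarrow> 'm \<Rightarrow> 'e) \<Rightarrow> ('m \<Rightarrow> 'e) \<Rightarrow> 'm \<Rightarrow> real" where
  "norm2_nabla g nabla E V p = (\<Sum>i<DIM('e). g p (nabla (E i) V p) (nabla (E i) V p))"

definition tension ::
    "('m \<Rightarrow> 'e \<Rightarrow> 'e \<Rightarrow> real) \<Rightarrow> ('m, 'e::euclidean_space) connection \<Rightarrow>
     (nat \<Rightarrow> 'm \<Rightarrow> 'e) \<Rightarrow> ('m \<Rightarrow> 'e) \<Rightarrow> 'm \<Rightarrow> 'e" where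
  "tension g nabla E \<xi> p = rough_laplacian nabla E \<xi> p - norm2_nabla g nabla E \<xi> p *\<^sub>R \<xi> p"

definition unit_vector_field ::
    "('m::topological_space, 'e::euclidean_space) manifold \<Rightarrow> ('m \<Rightarrow> 'e \<Rightarrow> 'e \<Rightarrow> real) \<Rightarrow>
     ('m \<Rightarrow> 'e) \<Rightarrow> bool" where
  "unit_vector_field M g \<xi> \<longleftrightarrow> smooth_vf M UNIV \<xi> \<and> (\<forall>p. g p (\<xi> p) (\<xi> p) = 1)"

definition harmonic_unit_field ::
    "('m::topological_space, 'e::euclidean_space) manifold \<Rightarrow> ('m \<Rightarrow> 'e \<Rightarrow> 'e \<Rightarrow> real) \<Rightarrow>
     ('m, 'e) connection \<Rightarrow> ('m \<Rightarrow> 'e) \<Rightarrow> bool" where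
  "harmonic_unit_field M g nabla \<xi> \<longleftrightarrow> unit_vector_field M g \<xi> \<and>
     (\<forall>U E. orthonormal_frame M g U E \<longrightarrow> (\<forall>p\<in>U. tension g nabla E \<xi> p = 0))"

text \<open>The orthogonal projection onto the distribution \<open>ker \<eta>\<close>, where \<open>\<eta> = g(\<xi>, _)\<close>.\<close>

definition proj_D ::
    "('m \<Rightarrow> 'e \<Rightarrow> 'e \<Rightarrow> real) \<Rightarrow> ('m \<Rightarrow> 'e::euclidean_space) \<Rightarrow> 'm \<Rightarrow> 'e \<Rightarrow> 'e" where
  "proj_D g \<xi> p v = v - g p (\<xi> p) v *\<^sub>R \<xi> p"

definition nabla_bar ::
    "('m \<Rightarrow> 'e \<Rightarrow> 'e \<Rightarrow> real) \<Rightarrow> ('m \<Rightarrow> 'e::euclidean_space) \<Rightarrow> ('m, 'e) connection \<Rightarrow>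
     ('m, 'e) connection" where
  "nabla_bar g \<xi> nabla X Y p = proj_D g \<xi> p (nabla X Y p)"

text \<open>
  \<open>(\<nabla>bar\<^sub>X J) Y\<close> for a section \<open>Y\<close> of \<open>ker \<eta>\<close>, on which \<open>J\<close> is the restriction of \<open>\<phi>\<close>.
\<close>

definition nabla_bar_J ::
    "('m \<Rightarrow> 'e \<Rightarrow> 'e \<Rightarrow> real) \<Rightarrow> ('m \<Rightarrow> 'e \<Rightarrow> 'e) \<Rightarrow> ('m \<Rightarrow> 'e::euclidean_space) \<Rightarrow>
     ('m, 'e) connection \<Rightarrow> ('m, 'e) connection" where
  "nabla_bar_J g \<phi> \<xi> nabla X Y p =
     nabla_bar g \<xi> nabla X (\<lambda>q. \<phi> q (Y q)) p - \<phi> p (nabla_bar g \<xi> nabla X Y p)"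

definition T_field ::
    "('m \<Rightarrow> 'e \<Rightarrow> 'e \<Rightarrow> real) \<Rightarrow> ('m \<Rightarrow> 'e \<Rightarrow> 'e) \<Rightarrow> ('m \<Rightarrow> 'e::euclidean_space) \<Rightarrow>
     ('m, 'e) connection \<Rightarrow> (nat \<Rightarrow> 'm \<Rightarrow> 'e) \<Rightarrow> 'm \<Rightarrow> 'e" where
  "T_field g \<phi> \<xi> nabla E p = (\<Sum>i<DIM('e). nabla_bar_J g \<phi> \<xi> nabla (E i) (nabla (E i) \<xi>) p)"

definition first_harmonic_section_equation ::
    "('m::topological_space, 'e::euclidean_space) manifold \<Rightarrow> ('m \<Rightarrow> 'e \<Rightarrow> 'e \<Rightarrow> real) \<Rightarrow>
     ('m \<Rightarrow> 'e \<Rightarrow> 'e) \<Rightarrow> ('m \<Rightarrow> 'e) \<Rightarrow> ('m, 'e) connection \<Rightarrow> bool" where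
  "first_harmonic_section_equation M g \<phi> \<xi> nabla \<longleftrightarrow>
     (\<forall>U E. orthonormal_frame M g U E \<longrightarrow>
        (\<forall>p\<in>U. tension g nabla E \<xi> p + (1/2) *\<^sub>R \<phi> p (T_field g \<phi> \<xi> nabla E p) = 0))"

section \<open>The warped product with the real line\<close>

definition line_chart :: "('m, 'e) chart \<Rightarrow> ('m \<times> real, 'e \<times> real) chart" where
  "line_chart c = \<lparr>cdom = cdom c \<times> UNIV, cmap = map_prod (cmap c) id\<rparr>"

text \<open>
  With these preferred charts the tangent space of the product at \<open>(p, t)\<close> is literally the
  product of the tangent spaces, and \<open>(0, 1)\<close> represents \<open>\<partial>\<^sub>t\<close>.
\<close>

definition line_product :: "('m, 'e) manifold \<Rightarrow> ('m \<times> real, 'e \<times> real) manifold" where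
  "line_product M = \<lparr>atlas = line_chart ` atlas M, chart_at = (\<lambda>(p, t). line_chart (chart_at M p))\<rparr>"

definition warped_metric ::
    "('m \<Rightarrow> 'e \<Rightarrow> 'e \<Rightarrow> real) \<Rightarrow> ('m \<Rightarrow> real) \<Rightarrow>
     'm \<times> real \<Rightarrow> 'e \<times> real \<Rightarrow> 'e \<times> real \<Rightarrow> real" where
  "warped_metric g f = (\<lambda>(p, t) (v, a) (w, b). g p v w + (f p)\<^sup>2 * (a * b))"

definition warped_reeb :: "('m \<Rightarrow> real) \<Rightarrow> 'm \<times> real \<Rightarrow> 'e::real_vector \<times> real" where
  "warped_reeb f = (\<lambda>(p, t). (0, inverse (f p)))"

definition warped_phi :: "('m \<Rightarrow> 'e \<Rightarrow> 'e) \<Rightarrow> 'm \<times> real \<Rightarrow> 'e \<times> real \<Rightarrow> 'e \<times> real" where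
  "warped_phi J = (\<lambda>(p, t) (v, a). (J p v, 0))"

end

theory Submission
  imports Defs
begin

text \<open>
  Write \<open>K = \<nabla>\<^sub>\<xi> \<xi>\<close>; this is the horizontal, \<open>t\<close>-independent field \<open>- grad (ln f)\<close>.  Since \<open>\<partial>\<^sub>t\<close> is
  a Killing field and \<open>ker \<eta>\<close> is integrable, \<open>\<nabla>\<^sub>X \<xi> = 0\<close> for horizontal \<open>X\<close>, hence
  \<open>\<nabla>\<^sub>X \<xi> = \<eta>(X) K\<close> for all \<open>X\<close>.  Moreover \<open>\<nabla>\<^sub>\<xi> Z\<close> is vertical for every field \<open>Z\<close> lifted from
  the base, so in particular \<open>\<nabla>\<^sub>\<xi> K = - |K|\<^sup>2 \<xi>\<close>.  As \<open>\<Sum> \<eta>(E\<^sub>i) E\<^sub>i = \<xi>\<close> for an orthonormal frame,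
  the trace of \<open>\<nabla>\<^sup>2\<xi>\<close> collapses to \<open>g(K, \<xi>) K + \<nabla>\<^sub>\<xi> K = - |K|\<^sup>2 \<xi>\<close>, while \<open>|\<nabla>\<xi>|\<^sup>2 = |K|\<^sup>2\<close>;
  thus \<open>\<tau>(\<xi>) = 0\<close>.  In the same way \<open>T(\<phi>)\<close> is the horizontal part of \<open>\<nabla>\<^sub>\<xi> (\<phi> K) - \<phi> (\<nabla>\<^sub>\<xi> K)\<close>,
  and both terms vanish because \<open>K\<close> and \<open>\<phi> K\<close> are lifted fields.
\<close>

section \<open>Calculus of smooth functions\<close>

lemma Ck_on_cong:
  assumes "open S" "\<And>x. x \<in> S \<Longrightarrow> f x = g x" "Ck_on k S f"
  shows "Ck_on k S g"
  using assms(2,3)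
proof (induction k arbitrary: f g)
  case 0
  have "continuous_on S f = continuous_on S g"
    by (rule continuous_on_cong) (simp_all add: 0)
  with 0 show ?case by simp
next
  case (Suc k)
  have g: "(g has_derivative frechet_derivative f (at x)) (at x)" if "x \<in> S" for x
  proof (rule has_derivative_transform_within_open[OF _ assms(1) that])
    show "(f has_derivative frechet_derivative f (at x)) (at x)"
      using Suc.prems(2) that by (simp add: frechet_derivative_works[symmetric])
  qed (rule Suc.prems(1))
  have eq: "frechet_derivative f (at x) = frechet_derivative g (at x)" if "x \<in> S" for x
    by (rule frechet_derivative_at[OF g[OF that]])
  have "Ck_on k S (\<lambda>x. frechet_derivative g (at x) v)" for v
    by (rule Suc.IH[of "\<lambda>x. frechet_derivative f (at x) v"]) (use Suc.prems(2) in \<open>simp_all add: eq\<close>)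
  with g show ?case unfolding Ck_on.simps differentiable_def by blast
qed

lemma Ck_on_subset: "Ck_on k S f \<Longrightarrow> T \<subseteq> S \<Longrightarrow> Ck_on k T f"
  by (induction k arbitrary: f) (auto intro: continuous_on_subset)

lemma Ck_on_Suc_imp: "Ck_on (Suc k) S f \<Longrightarrow> Ck_on k S f"
proof (induction k arbitrary: f)
  case 0
  then have "f differentiable_on S"
    by (auto simp: differentiable_on_def differentiable_at_withinI)
  then show ?case by (simp add: differentiable_imp_continuous_on)
next
  case (Suc k)
  then have "Ck_on k S (\<lambda>x. frechet_derivative f (at x) v)" for v
    using Ck_on.simps(2) by blast
  with Suc.prems show ?case by auto
qed

text \<open>Derivatives are unique, so any family \<open>F\<close> of derivatives may stand in for
  \<open>frechet_derivative\<close>. The inductions below can then work with explicit product, chain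
  and quotient rules.\<close>

lemma Ck_on_SucI:
  assumes "open S" "\<And>x. x \<in> S \<Longrightarrow> (f has_derivative F x) (at x)" "\<And>v. Ck_on k S (\<lambda>x. F x v)"
  shows "Ck_on (Suc k) S f"
proof -
  have "F x = frechet_derivative f (at x)" if "x \<in> S" for x
    by (rule frechet_derivative_at[OF assms(2)[OF that]])
  then have "Ck_on k S (\<lambda>x. frechet_derivative f (at x) v)" for v
    using Ck_on_cong[OF assms(1) _ assms(3)[of v]] by simp
  then show ?thesis using assms(2) unfolding Ck_on.simps differentiable_def by blast
qed

lemma Ck_on_SucD:
  assumes "Ck_on (Suc k) S f"
  shows "x \<in> S \<Longrightarrow> (f has_derivative frechet_derivative f (at x)) (at x)"
    and "Ck_on k S (\<lambda>x. frechet_derivative f (at x) v)"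
  using assms by (simp_all add: frechet_derivative_works[symmetric])

lemma Ck_on_const: "open S \<Longrightarrow> Ck_on k S (\<lambda>x. c)"
proof (induction k arbitrary: c)
  case (Suc k)
  then show ?case by (intro Ck_on_SucI[where F = "\<lambda>_ _. 0"]) simp_all
qed simp

lemma Ck_on_linear:
  fixes L :: "'a::euclidean_space \<Rightarrow> 'b::euclidean_space"
  assumes "open S" "linear L"
  shows "Ck_on k S L"
proof (cases k)
  case 0
  then show ?thesis using assms(2) by (simp add: linear_continuous_on linear_linear)
next
  case (Suc k')
  show ?thesis unfolding Suc
    by (rule Ck_on_SucI[where F = "\<lambda>_. L"])
      (simp_all add: assms Ck_on_const bounded_linear_imp_has_derivative linear_linear)
qed

lemma Ck_on_add:
  assumes "open S" "Ck_on k S f" "Ck_on k S g"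
  shows "Ck_on k S (\<lambda>x. f x + g x)"
  using assms(2,3)
proof (induction k arbitrary: f g)
  case 0
  then show ?case by (auto intro: continuous_on_add)
next
  case (Suc k)
  note f = Ck_on_SucD[OF Suc.prems(1)] and g = Ck_on_SucD[OF Suc.prems(2)]
  show ?case
    by (rule Ck_on_SucI[OF assms(1) has_derivative_add[OF f(1) g(1)]]) (simp_all only: Suc.IH f(2) g(2))
qed

lemma Ck_on_sum:
  assumes "open S" "\<And>i. i \<in> I \<Longrightarrow> Ck_on k S (f i)"
  shows "Ck_on k S (\<lambda>x. \<Sum>i\<in>I. f i x)"
  using assms(2)
  by (induction I rule: infinite_finite_induct) (simp_all add: Ck_on_const[OF assms(1)] Ck_on_add[OF assms(1)])

text \<open>By the Leibniz rule the derivative is a sum of two products of the same kind, in each of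
  which one factor is differentiated. The other factor is only used at the lower order, so the
  induction hypothesis applies to both.\<close>

lemma Ck_on_bilinear:
  fixes prod :: "'b::euclidean_space \<Rightarrow> 'c::euclidean_space \<Rightarrow> 'd::euclidean_space"
  assumes "open S" "bounded_bilinear prod" "Ck_on k S f" "Ck_on k S g"
  shows "Ck_on k S (\<lambda>x. prod (f x) (g x))"
  using assms(3,4)
proof (induction k arbitrary: f g)
  case 0
  then show ?case using bounded_bilinear.continuous_on[OF assms(2)] by auto
next
  case (Suc k)
  note f = Ck_on_SucD[OF Suc.prems(1)] and g = Ck_on_SucD[OF Suc.prems(2)]
  show ?case
    by (rule Ck_on_SucI[OF assms(1) bounded_bilinear.FDERIV[OF assms(2) f(1) g(1)]])
      (intro Ck_on_add[OF assms(1)] Suc.IH f(2) g(2) Ck_on_Suc_imp[OF Suc.prems(1)]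
        Ck_on_Suc_imp[OF Suc.prems(2)] | assumption)+
qed

lemma Ck_on_compose:
  fixes f :: "'b::euclidean_space \<Rightarrow> 'c::euclidean_space" and g :: "'a::euclidean_space \<Rightarrow> 'b"
  assumes "open S" "Ck_on k T f" "Ck_on k S g" "g ` S \<subseteq> T"
  shows "Ck_on k S (\<lambda>x. f (g x))"
  using assms(2,3)
proof (induction k arbitrary: f)
  case 0
  then show ?case using assms(4) by (auto intro: continuous_on_compose2)
next
  case (Suc k)
  note f = Ck_on_SucD[OF Suc.prems(1)] and g = Ck_on_SucD[OF Suc.prems(2)]
  \<comment> \<open>In the chain rule the derivative of \<open>f\<close> is applied to a direction
    that moves with \<open>x\<close>. Expanding this direction in the basis leaves only derivatives
    of \<open>f\<close> in fixed directions composed with \<open>g\<close>, which the induction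
    hypothesis covers.\<close>
  let ?F = "\<lambda>x v. \<Sum>b\<in>Basis. (frechet_derivative g (at x) v \<bullet> b) *\<^sub>R frechet_derivative f (at (g x)) b"
  show ?case
  proof (rule Ck_on_SucI[OF assms(1), where F = ?F])
    fix x assume x: "x \<in> S"
    then have gx: "g x \<in> T" using assms(4) by auto
    have lin: "linear (frechet_derivative f (at (g x)))"
      using f(1)[OF gx] has_derivative_linear by blast
    have "?F x v = frechet_derivative f (at (g x)) (\<Sum>b\<in>Basis. (frechet_derivative g (at x) v \<bullet> b) *\<^sub>R b)" for v
      by (simp only: linear_sum[OF lin] linear_scale[OF lin])
    then have "?F x = frechet_derivative f (at (g x)) \<circ> frechet_derivative g (at x)"
      by (simp add: fun_eq_iff euclidean_representation)
    then show "((\<lambda>x. f (g x)) has_derivative ?F x) (at x)"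
      using diff_chain_at[OF g(1)[OF x] f(1)[OF gx]] by (simp add: o_def)
  next
    fix v
    have "Ck_on k S (\<lambda>x. frechet_derivative g (at x) v \<bullet> b)" for b
      by (rule Ck_on_bilinear[OF assms(1) bounded_bilinear_inner g(2) Ck_on_const[OF assms(1)]])
    moreover have "Ck_on k S (\<lambda>x. frechet_derivative f (at (g x)) b)" for b
      by (rule Suc.IH[OF f(2) Ck_on_Suc_imp[OF Suc.prems(2)]])
    ultimately show "Ck_on k S (\<lambda>x. ?F x v)"
      by (rule_tac Ck_on_sum[OF assms(1)], rule_tac Ck_on_bilinear[OF assms(1) bounded_bilinear_scaleR]) simp_all
  qed
qed

lemma Ck_on_inverse:
  fixes f :: "'a::euclidean_space \<Rightarrow> real"
  assumes "open S" "Ck_on k S f" "\<And>x. x \<in> S \<Longrightarrow> f x \<noteq> 0"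
  shows "Ck_on k S (\<lambda>x. inverse (f x))"
  using assms(2)
proof (induction k)
  case 0
  then show ?case using assms(3) by (auto intro: continuous_on_inverse)
next
  case (Suc k)
  note f = Ck_on_SucD[OF Suc.prems]
  have i: "Ck_on k S (\<lambda>x. inverse (f x))" by (rule Suc.IH[OF Ck_on_Suc_imp[OF Suc.prems]])
  note m = Ck_on_bilinear[OF assms(1) bounded_bilinear_mult]
  \<comment> \<open>The derivative of the inverse contains the inverse itself, but one order lower,
    where the induction hypothesis \<open>i\<close> supplies it.\<close>
  have "Ck_on k S (\<lambda>x. (-1) * (inverse (f x) * frechet_derivative f (at x) v * inverse (f x)))" for v
    by (rule m[OF Ck_on_const[OF assms(1)] m[OF m[OF i f(2)] i]])
  then show ?case
    by (rule_tac Ck_on_SucI[OF assms(1) Deriv.has_derivative_inverse[OF assms(3) f(1)]]) simp_all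
qed

section \<open>Closure properties of smooth functions, order by order\<close>

lemma smooth_on_cong:
  "open S \<Longrightarrow> (\<And>x. x \<in> S \<Longrightarrow> f x = g x) \<Longrightarrow> smooth_on S f \<Longrightarrow> smooth_on S g"
  unfolding smooth_on_def by (simp add: Ck_on_cong[of S f g])

lemma smooth_on_subset: "smooth_on S f \<Longrightarrow> T \<subseteq> S \<Longrightarrow> smooth_on T f"
  unfolding smooth_on_def by (simp add: Ck_on_subset[of _ S f T])

lemma smooth_on_differentiable: "smooth_on S f \<Longrightarrow> x \<in> S \<Longrightarrow> f differentiable (at x)"
  unfolding smooth_on_def by (metis Ck_on.simps(2))

lemma smooth_on_derivative: "smooth_on S f \<Longrightarrow> smooth_on S (\<lambda>x. frechet_derivative f (at x) v)"
  unfolding smooth_on_def by (metis Ck_on.simps(2))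

lemma smooth_on_const: "open S \<Longrightarrow> smooth_on S (\<lambda>x. c)"
  unfolding smooth_on_def by (simp add: Ck_on_const)

lemma smooth_on_linear: "open S \<Longrightarrow> linear L \<Longrightarrow> smooth_on S L"
  unfolding smooth_on_def by (simp add: Ck_on_linear)

lemma smooth_on_add:
  "open S \<Longrightarrow> smooth_on S f \<Longrightarrow> smooth_on S g \<Longrightarrow> smooth_on S (\<lambda>x. f x + g x)"
  unfolding smooth_on_def by (simp add: Ck_on_add)

lemma smooth_on_bilinear:
  fixes prod :: "'b::euclidean_space \<Rightarrow> 'c::euclidean_space \<Rightarrow> 'd::euclidean_space"
  assumes "open S" "bounded_bilinear prod" "smooth_on S f" "smooth_on S g"
  shows "smooth_on S (\<lambda>x. prod (f x) (g x))"
  using assms unfolding smooth_on_def by (simp add: Ck_on_bilinear)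

lemmas smooth_on_scaleR = smooth_on_bilinear[OF _ bounded_bilinear_scaleR]
lemmas smooth_on_mult = smooth_on_bilinear[OF _ bounded_bilinear_mult[where 'a = real]]

lemma smooth_on_compose:
  "open S \<Longrightarrow> smooth_on T f \<Longrightarrow> smooth_on S g \<Longrightarrow> g ` S \<subseteq> T \<Longrightarrow> smooth_on S (\<lambda>x. f (g x))"
  unfolding smooth_on_def by (simp add: Ck_on_compose[of S _ T])

lemma smooth_on_linear_compose:
  "open S \<Longrightarrow> linear L \<Longrightarrow> smooth_on S f \<Longrightarrow> smooth_on S (\<lambda>x. L (f x))"
  by (rule smooth_on_compose[OF _ smooth_on_linear[of UNIV L]]) simp_all

lemma smooth_on_inverse:
  fixes f :: "'a::euclidean_space \<Rightarrow> real"
  shows "open S \<Longrightarrow> smooth_on S f \<Longrightarrow> (\<And>x. x \<in> S \<Longrightarrow> f x \<noteq> 0) \<Longrightarrow> smooth_on S (\<lambda>x. inverse (f x))"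
  unfolding smooth_on_def by (simp add: Ck_on_inverse)

text \<open>A pair is the sum of its two images under the linear coordinate embeddings.\<close>

lemma smooth_on_Pair:
  assumes "open S" "smooth_on S f" "smooth_on S g"
  shows "smooth_on S (\<lambda>x. (f x, g x))"
proof -
  have "smooth_on S (\<lambda>x. (f x, 0))" "smooth_on S (\<lambda>x. (0, g x))"
    by (rule smooth_on_linear_compose[OF assms(1) _ assms(2)], simp add: linear_iff)
      (rule smooth_on_linear_compose[OF assms(1) _ assms(3)], simp add: linear_iff)
  from smooth_on_add[OF assms(1) this]
  show ?thesis by simp
qed

section \<open>Charts and vector fields\<close>

text \<open>Both functions have the same set of derivatives at \<open>x\<close>, so the choice made
  in \<open>frechet_derivative\<close> agrees even where neither is differentiable.\<close>

lemma frechet_derivative_cong: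
  assumes "open S" "x \<in> S" "\<And>y. y \<in> S \<Longrightarrow> f y = h y"
  shows "frechet_derivative f (at x) = frechet_derivative h (at x)"
proof -
  have "(f has_derivative D) (at x) \<longleftrightarrow> (h has_derivative D) (at x)" for D
    using has_derivative_transform_within_open[OF _ assms(1,2), of f D UNIV h]
      has_derivative_transform_within_open[OF _ assms(1,2), of h D UNIV f] assms(3) by auto
  then show ?thesis by (simp add: frechet_derivative_def)
qed

section \<open>Jacobians of coordinate changes and coordinate fields\<close>

definition transition_deriv ::
    "('m, 'e::euclidean_space) chart \<Rightarrow> ('m, 'e) chart \<Rightarrow> 'm \<Rightarrow> 'e \<Rightarrow> 'e" where
  "transition_deriv c d p = frechet_derivative (cmap d \<circ> cinv c) (at (cmap c p))"

text \<open>The vector field on the domain of \<open>c\<close> with constant components \<open>b\<close> in the chart \<open>c\<close>.\<close>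

definition coord_field ::
    "('m, 'e::euclidean_space) manifold \<Rightarrow> ('m, 'e) chart \<Rightarrow> 'e \<Rightarrow> 'm \<Rightarrow> 'e" where
  "coord_field M c b p = transition_deriv c (chart_at M p) p b"

lemma components_eq: "components M c p = transition_deriv (chart_at M p) c p"
  by (simp add: fun_eq_iff components_def transition_deriv_def)

lemma smooth_vf_subset: "smooth_vf M U X \<Longrightarrow> V \<subseteq> U \<Longrightarrow> smooth_vf M V X"
  unfolding smooth_vf_def by (fast intro: smooth_on_subset)

lemma smooth_fun_subset: "smooth_fun M U h \<Longrightarrow> V \<subseteq> U \<Longrightarrow> smooth_fun M V h"
  unfolding smooth_fun_def by (fast intro: smooth_on_subset)

locale manifold_loc =
  fixes M :: "('m::{t2_space, second_countable_topology}, 'e::euclidean_space) manifold"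
  assumes smooth_manifold: "smooth_manifold M"
begin

lemma chart_at_atlas [simp]: "chart_at M p \<in> atlas M"
  and chart_at_mem [simp]: "p \<in> cdom (chart_at M p)"
  using smooth_manifold by (auto simp: smooth_manifold_def)

lemma is_chart: "c \<in> atlas M \<Longrightarrow> is_chart c"
  using smooth_manifold by (auto simp: smooth_manifold_def)

lemma open_cdom [simp]: "c \<in> atlas M \<Longrightarrow> open (cdom c)"
  using is_chart by (auto simp: is_chart_def)

lemma cinv_cmap [simp]: "c \<in> atlas M \<Longrightarrow> p \<in> cdom c \<Longrightarrow> cinv c (cmap c p) = p"
  using is_chart[of c] by (auto simp: is_chart_def homeomorphism_def)

lemma open_chart_image:
  assumes "c \<in> atlas M" "open U"
  shows "open (cmap c ` (U \<inter> cdom c))"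
proof -
  have "cmap c ` (U \<inter> cdom c) = cmap c ` cdom c \<inter> cinv c -` U"
    using cinv_cmap[OF assms(1)] by force
  moreover have "continuous_on (cmap c ` cdom c) (cinv c)" "open (cmap c ` cdom c)"
    using is_chart[OF assms(1)] by (auto simp: is_chart_def homeomorphism_def)
  ultimately show ?thesis
    using continuous_open_preimage assms(2) by metis
qed

lemma smooth_transition:
  assumes "c \<in> atlas M" "d \<in> atlas M"
  shows "smooth_on (cmap c ` (cdom c \<inter> cdom d)) (cmap d \<circ> cinv c)"
  using assms smooth_manifold by (auto simp: smooth_manifold_def)

lemma has_derivative_transition:
  assumes "c \<in> atlas M" "d \<in> atlas M" "p \<in> cdom c" "p \<in> cdom d"
  shows "(cmap d \<circ> cinv c has_derivative transition_deriv c d p) (at (cmap c p))"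
  unfolding transition_deriv_def frechet_derivative_works[symmetric]
  using smooth_on_differentiable[OF smooth_transition[OF assms(1,2)]] assms(3,4) by blast

lemma linear_transition:
  assumes "c \<in> atlas M" "d \<in> atlas M" "p \<in> cdom c" "p \<in> cdom d"
  shows "linear (transition_deriv c d p)"
  using has_derivative_transition[OF assms] has_derivative_linear by blast

text \<open>Cocycle rule for Jacobians: the chain rule for two successive coordinate changes, whose
  composite agrees near \<open>p\<close> with the direct one.\<close>

lemma transition_deriv_trans:
  assumes "c \<in> atlas M" "d \<in> atlas M" "e \<in> atlas M" "p \<in> cdom c" "p \<in> cdom d" "p \<in> cdom e"
  shows "transition_deriv d e p (transition_deriv c d p v) = transition_deriv c e p v"
proof -
  have 1: "(cmap d \<circ> cinv c) (cmap c p) = cmap d p" using assms by simp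
  have "(cmap e \<circ> cinv d \<circ> (cmap d \<circ> cinv c) has_derivative
      transition_deriv d e p \<circ> transition_deriv c d p) (at (cmap c p))"
    using diff_chain_at[OF has_derivative_transition[OF assms(1,2,4,5)]] 1
      has_derivative_transition[OF assms(2,3,5,6)] by metis
  then have "(cmap e \<circ> cinv c has_derivative transition_deriv d e p \<circ> transition_deriv c d p) (at (cmap c p))"
    by (rule has_derivative_transform_within_open[OF _ open_chart_image[OF assms(1) open_cdom[OF assms(2)]]])
      (use assms in auto)
  from fun_cong[OF frechet_derivative_at[OF this], of v] show ?thesis
    by (simp only: transition_deriv_def[of c e] comp_apply)
qed

lemma transition_deriv_self:
  assumes "c \<in> atlas M" "p \<in> cdom c"
  shows "transition_deriv c c p v = v"
proof -
  have "frechet_derivative (cmap c \<circ> cinv c) (at (cmap c p)) = frechet_derivative (\<lambda>x. x) (at (cmap c p))"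
    by (rule frechet_derivative_cong[OF open_chart_image[OF assms(1) open_UNIV]]) (use assms in auto)
  then show ?thesis by (simp add: transition_deriv_def)
qed

lemma linear_components: "c \<in> atlas M \<Longrightarrow> p \<in> cdom c \<Longrightarrow> linear (components M c p)"
  by (simp add: components_eq linear_transition)

lemma components_chart_at [simp]: "components M (chart_at M p) p v = v"
  by (simp add: components_eq transition_deriv_self)

lemma components_coord_field:
  assumes "c \<in> atlas M" "d \<in> atlas M" "p \<in> cdom c" "p \<in> cdom d"
  shows "components M d p (coord_field M c b p) = transition_deriv c d p b"
  by (simp add: components_eq coord_field_def transition_deriv_trans assms)

lemma coord_field_chart_at [simp]: "coord_field M (chart_at M p) b p = b"
  by (simp add: coord_field_def transition_deriv_self)

lemma coord_field_components:
  "c \<in> atlas M \<Longrightarrow> p \<in> cdom c \<Longrightarrow> coord_field M c (components M c p v) p = v"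
  by (simp add: components_eq coord_field_def transition_deriv_trans transition_deriv_self)

lemma linear_coord_field: "c \<in> atlas M \<Longrightarrow> p \<in> cdom c \<Longrightarrow> linear (\<lambda>b. coord_field M c b p)"
  using linear_transition[of c "chart_at M p" p] by (simp add: coord_field_def)

text \<open>The coordinate fields of one chart are a basis at each of its points. This reduces
  expressions that are linear over functions in a field to coordinate fields.\<close>

lemma coord_field_expansion:
  assumes "c \<in> atlas M" "p \<in> cdom c"
  shows "v = (\<Sum>b\<in>Basis. (components M c p v \<bullet> b) *\<^sub>R coord_field M c b p)"
proof -
  note lin = linear_coord_field[OF assms]
  have "v = coord_field M c (\<Sum>b\<in>Basis. (components M c p v \<bullet> b) *\<^sub>R b) p"
    by (simp add: euclidean_representation coord_field_components assms)
  also have "\<dots> = (\<Sum>b\<in>Basis. (components M c p v \<bullet> b) *\<^sub>R coord_field M c b p)"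
    by (simp only: linear_sum[OF lin] linear_scale[OF lin])
  finally show ?thesis .
qed

text \<open>Chart images of open sets are open, so only the values there count; smoothness can be
  checked on any convenient coordinate expression \<open>F c\<close>.\<close>

lemma smooth_vfI:
  assumes "open U"
    and "\<And>c. c \<in> atlas M \<Longrightarrow> smooth_on (cmap c ` (U \<inter> cdom c)) (F c)"
    and "\<And>c p. c \<in> atlas M \<Longrightarrow> p \<in> U \<Longrightarrow> p \<in> cdom c \<Longrightarrow> F c (cmap c p) = components M c p (X p)"
  shows "smooth_vf M U X"
  unfolding smooth_vf_def
proof
  fix c assume c: "c \<in> atlas M"
  show "smooth_on (cmap c ` (U \<inter> cdom c)) (\<lambda>x. components M c (cinv c x) (X (cinv c x)))"
    by (rule smooth_on_cong[OF open_chart_image[OF c assms(1)] _ assms(2)[OF c]])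
      (use c assms(3) in auto)
qed

lemma smooth_funI:
  assumes "open U"
    and "\<And>c. c \<in> atlas M \<Longrightarrow> smooth_on (cmap c ` (U \<inter> cdom c)) (F c)"
    and "\<And>c p. c \<in> atlas M \<Longrightarrow> p \<in> U \<Longrightarrow> p \<in> cdom c \<Longrightarrow> F c (cmap c p) = h p"
  shows "smooth_fun M U h"
  unfolding smooth_fun_def
proof
  fix c assume c: "c \<in> atlas M"
  show "smooth_on (cmap c ` (U \<inter> cdom c)) (h \<circ> cinv c)"
    by (rule smooth_on_cong[OF open_chart_image[OF c assms(1)] _ assms(2)[OF c]])
      (use c assms(3) in auto)
qed

lemma smooth_vfD:
  "smooth_vf M U X \<Longrightarrow> c \<in> atlas M \<Longrightarrow>
    smooth_on (cmap c ` (U \<inter> cdom c)) (\<lambda>x. components M c (cinv c x) (X (cinv c x)))"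
  by (simp add: smooth_vf_def)

lemma smooth_funD:
  "smooth_fun M U h \<Longrightarrow> c \<in> atlas M \<Longrightarrow> smooth_on (cmap c ` (U \<inter> cdom c)) (\<lambda>x. h (cinv c x))"
  by (simp add: smooth_fun_def o_def)

lemma smooth_vf_cong:
  assumes "open U" "smooth_vf M U X" "\<And>p. p \<in> U \<Longrightarrow> X p = Y p"
  shows "smooth_vf M U Y"
  by (rule smooth_vfI[OF assms(1) smooth_vfD[OF assms(2)]]) (use assms(3) in auto)

lemma smooth_fun_cong:
  assumes "open U" "smooth_fun M U h" "\<And>p. p \<in> U \<Longrightarrow> h p = k p"
  shows "smooth_fun M U k"
  by (rule smooth_funI[OF assms(1) smooth_funD[OF assms(2)]]) (use assms(3) in auto)

lemma smooth_fun_const: "open U \<Longrightarrow> smooth_fun M U (\<lambda>p. k)"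
  by (rule smooth_funI[where F = "\<lambda>_ _. k"]) (auto intro: smooth_on_const open_chart_image)

lemma smooth_fun_mult:
  assumes "open U" "smooth_fun M U h" "smooth_fun M U k"
  shows "smooth_fun M U (\<lambda>p. h p * k p)"
  by (rule smooth_funI[OF assms(1) smooth_on_mult[OF open_chart_image[OF _ assms(1)]
          smooth_funD[OF assms(2)] smooth_funD[OF assms(3)]]]) auto

lemma smooth_fun_inverse:
  assumes "open U" "smooth_fun M U h" "\<And>p. p \<in> U \<Longrightarrow> h p \<noteq> 0"
  shows "smooth_fun M U (\<lambda>p. inverse (h p))"
  by (rule smooth_funI[OF assms(1) smooth_on_inverse[OF open_chart_image[OF _ assms(1)]
          smooth_funD[OF assms(2)]]]) (use assms(3) in auto)

lemma smooth_vf_scale: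
  assumes "open U" "smooth_fun M U h" "smooth_vf M U X"
  shows "smooth_vf M U (\<lambda>p. h p *\<^sub>R X p)"
  by (rule smooth_vfI[OF assms(1) smooth_on_scaleR[OF open_chart_image[OF _ assms(1)]
          smooth_funD[OF assms(2)] smooth_vfD[OF assms(3)]]])
    (auto simp: linear_scale[OF linear_components])

lemma smooth_vf_add:
  assumes "open U" "smooth_vf M U X" "smooth_vf M U Y"
  shows "smooth_vf M U (\<lambda>p. X p + Y p)"
  by (rule smooth_vfI[OF assms(1) smooth_on_add[OF open_chart_image[OF _ assms(1)]
          smooth_vfD[OF assms(2)] smooth_vfD[OF assms(3)]]])
    (auto simp: linear_add[OF linear_components])

lemma smooth_vf_zero: "open U \<Longrightarrow> smooth_vf M U (\<lambda>p. 0)"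
  by (rule smooth_vfI[where F = "\<lambda>_ _. 0"])
    (auto intro: smooth_on_const open_chart_image simp: linear_0[OF linear_components])

lemma smooth_vf_sum:
  assumes "open U" "\<And>i. i \<in> I \<Longrightarrow> smooth_vf M U (X i)"
  shows "smooth_vf M U (\<lambda>p. \<Sum>i\<in>I. X i p)"
  using assms(2)
  by (induction I rule: infinite_finite_induct)
    (simp_all add: smooth_vf_zero[OF assms(1)] smooth_vf_add[OF assms(1)])

text \<open>In another chart \<open>d\<close> the components are a directional derivative of the
  transition from \<open>c\<close> to \<open>d\<close>, precomposed with the transition from
  \<open>d\<close> to \<open>c\<close>; both are smooth.\<close>

lemma smooth_coord_field:
  assumes "c \<in> atlas M"
  shows "smooth_vf M (cdom c) (coord_field M c b)"
proof (rule smooth_vfI)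
  fix d assume d: "d \<in> atlas M"
  show "smooth_on (cmap d ` (cdom c \<inter> cdom d))
      (\<lambda>x. frechet_derivative (cmap d \<circ> cinv c) (at ((cmap c \<circ> cinv d) x)) b)"
  proof (rule smooth_on_compose[where g = "cmap c \<circ> cinv d" and T = "cmap c ` (cdom c \<inter> cdom d)"
          and f = "\<lambda>x. frechet_derivative (cmap d \<circ> cinv c) (at x) b"])
    show "open (cmap d ` (cdom c \<inter> cdom d))"
      by (rule open_chart_image[OF d open_cdom[OF assms]])
    show "smooth_on (cmap c ` (cdom c \<inter> cdom d)) (\<lambda>x. frechet_derivative (cmap d \<circ> cinv c) (at x) b)"
      by (rule smooth_on_derivative[OF smooth_transition[OF assms d]])
    show "smooth_on (cmap d ` (cdom c \<inter> cdom d)) (cmap c \<circ> cinv d)"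
      using smooth_transition[OF d assms] by (simp add: Int_commute)
    show "(cmap c \<circ> cinv d) ` cmap d ` (cdom c \<inter> cdom d) \<subseteq> cmap c ` (cdom c \<inter> cdom d)"
      using d by auto
  qed
qed (use assms in \<open>auto simp: components_coord_field transition_deriv_def\<close>)

text \<open>A single chart containing \<open>U\<close> suffices, since the expressions in other
  charts arise by composing with smooth transitions.\<close>

lemma smooth_fun_chart:
  assumes "open U" "c \<in> atlas M" "U \<subseteq> cdom c" "smooth_on (cmap c ` U) F"
    and "\<And>p. p \<in> U \<Longrightarrow> h p = F (cmap c p)"
  shows "smooth_fun M U h"
proof (rule smooth_funI[OF assms(1)])
  fix d assume d: "d \<in> atlas M"
  show "smooth_on (cmap d ` (U \<inter> cdom d)) (\<lambda>x. F ((cmap c \<circ> cinv d) x))"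
  proof (rule smooth_on_compose[OF open_chart_image[OF d assms(1)] assms(4)])
    show "smooth_on (cmap d ` (U \<inter> cdom d)) (cmap c \<circ> cinv d)"
      by (rule smooth_on_subset[OF smooth_transition[OF d assms(2)]]) (use assms(3) in auto)
  qed (use d in auto)
qed (use assms(5) in auto)

lemma smooth_fun_component:
  assumes "open U" "c \<in> atlas M" "smooth_vf M U X"
  shows "smooth_fun M (U \<inter> cdom c) (\<lambda>p. components M c p (X p) \<bullet> b)"
proof (rule smooth_fun_chart[OF _ assms(2)])
  show "smooth_on (cmap c ` (U \<inter> cdom c)) (\<lambda>x. components M c (cinv c x) (X (cinv c x)) \<bullet> b)"
    by (rule smooth_on_bilinear[OF open_chart_image[OF assms(2,1)] bounded_bilinear_inner
          smooth_vfD[OF assms(3,2)] smooth_on_const[OF open_chart_image[OF assms(2,1)]]])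
qed (use assms in auto)

lemma smooth_fun_coord:
  assumes "c \<in> atlas M"
  shows "smooth_fun M (cdom c) (\<lambda>p. cmap c p \<bullet> b)"
proof (rule smooth_fun_chart[OF _ assms])
  show "smooth_on (cmap c ` cdom c) (\<lambda>x. x \<bullet> b)"
    using open_chart_image[OF assms open_UNIV] 
    by (intro smooth_on_linear) (auto simp: bounded_linear.linear bounded_linear_inner_left)
qed (use assms in auto)

section \<open>Derivatives of functions along fields\<close>

lemma dir_deriv_cong:
  assumes "open U" "p \<in> U" "\<And>q. q \<in> U \<Longrightarrow> h q = k q"
  shows "dir_deriv M X h p = dir_deriv M X k p"
proof -
  have "frechet_derivative (h \<circ> cinv (chart_at M p)) (at (cmap (chart_at M p) p))
      = frechet_derivative (k \<circ> cinv (chart_at M p)) (at (cmap (chart_at M p) p))"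
    by (rule frechet_derivative_cong[OF open_chart_image[OF chart_at_atlas assms(1)]])
      (use assms in auto)
  then show ?thesis by (simp add: dir_deriv_def)
qed

lemma dir_deriv_const:
  assumes "open U" "p \<in> U" "\<And>q. q \<in> U \<Longrightarrow> h q = k"
  shows "dir_deriv M X h p = 0"
  using dir_deriv_cong[of U p h "\<lambda>_. k"] assms by (simp add: dir_deriv_def o_def)

text \<open>Chain rule: the Jacobian from the preferred chart to \<open>c\<close> is absorbed into
  the components of the vector, so any chart around \<open>p\<close> may be used.\<close>

lemma dir_deriv_chart:
  assumes "smooth_fun M U h" "c \<in> atlas M" "p \<in> cdom c" "p \<in> U" "open U"
  shows "dir_deriv M X h p = frechet_derivative (h \<circ> cinv c) (at (cmap c p)) (components M c p (X p))"
proof -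
  let ?d = "chart_at M p"
  have 1: "(cmap c \<circ> cinv ?d) (cmap ?d p) = cmap c p" by simp
  have "(h \<circ> cinv c) differentiable (at (cmap c p))"
    using smooth_on_differentiable[of "cmap c ` (U \<inter> cdom c)"] assms by (auto simp: smooth_fun_def)
  then have "(h \<circ> cinv c has_derivative frechet_derivative (h \<circ> cinv c) (at (cmap c p))) (at (cmap c p))"
    by (simp only: frechet_derivative_works)
  then have "(h \<circ> cinv c \<circ> (cmap c \<circ> cinv ?d) has_derivative
      frechet_derivative (h \<circ> cinv c) (at (cmap c p)) \<circ> transition_deriv ?d c p) (at (cmap ?d p))"
    using diff_chain_at[OF has_derivative_transition[OF chart_at_atlas assms(2) chart_at_mem assms(3)]] 1
    by metis
  then have "(h \<circ> cinv ?d has_derivative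
      frechet_derivative (h \<circ> cinv c) (at (cmap c p)) \<circ> transition_deriv ?d c p) (at (cmap ?d p))"
    by (rule has_derivative_transform_within_open[OF _
          open_chart_image[OF chart_at_atlas open_Int[OF assms(5) open_cdom[OF assms(2)]]]])
      (use assms in auto)
  from fun_cong[OF frechet_derivative_at[OF this], of "X p"] show ?thesis
    by (simp add: dir_deriv_def components_eq)
qed

end

section \<open>Locality and linearity of affine connections\<close>

locale connection_loc = manifold_loc M
  for M :: "('m::{t2_space, second_countable_topology}, 'e::euclidean_space) manifold" +
  fixes nabla :: "('m, 'e) connection"
  assumes affine: "affine_connection M nabla"
begin

lemmas smooth_nabla = affine[unfolded affine_connection_def, THEN conjunct1, rule_format]
  and nabla_add_left = affine[unfolded affine_connection_def, THEN conjunct2, THEN conjunct1, rule_format]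
  and nabla_scale_left =
    affine[unfolded affine_connection_def, THEN conjunct2, THEN conjunct2, THEN conjunct1, rule_format]
  and nabla_add_right =
    affine[unfolded affine_connection_def, THEN conjunct2, THEN conjunct2, THEN conjunct2, THEN conjunct1,
      rule_format]
  and nabla_scale_right =
    affine[unfolded affine_connection_def, THEN conjunct2, THEN conjunct2, THEN conjunct2, THEN conjunct2,
      rule_format]

text \<open>Locality: a field vanishing on \<open>U\<close> equals its product with the indicator function of the complement of \<open>U\<close>.\<close>

lemma smooth_fun_indicator: "open U \<Longrightarrow> smooth_fun M U (\<lambda>q. if q \<in> U then 0 else 1)"
  by (rule smooth_fun_cong[OF _ smooth_fun_const[of U 0]]) auto

lemma nabla_zero_left:
  assumes "open U" "p \<in> U" "smooth_vf M U Y" "\<And>q. q \<in> U \<Longrightarrow> X q = 0"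
  shows "nabla X Y p = 0"
proof -
  let ?h = "\<lambda>q. if q \<in> U then 0 else 1 :: real"
  have X: "smooth_vf M U X"
    by (rule smooth_vf_cong[OF assms(1) smooth_vf_zero[OF assms(1)]]) (simp add: assms(4))
  have "X = (\<lambda>q. ?h q *\<^sub>R X q)" using assms(4) by (auto simp: fun_eq_iff)
  then show ?thesis
    using nabla_scale_left[OF assms(1) smooth_fun_indicator[OF assms(1)] X assms(3,2)] assms(2) by simp
qed

lemma nabla_zero_right:
  assumes "open U" "p \<in> U" "smooth_vf M U X" "\<And>q. q \<in> U \<Longrightarrow> Y q = 0"
  shows "nabla X Y p = 0"
proof -
  let ?h = "\<lambda>q. if q \<in> U then 0 else 1 :: real"
  have Y: "smooth_vf M U Y"
    by (rule smooth_vf_cong[OF assms(1) smooth_vf_zero[OF assms(1)]]) (simp add: assms(4))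
  have "Y = (\<lambda>q. ?h q *\<^sub>R Y q)" using assms(4) by (auto simp: fun_eq_iff)
  \<comment> \<open>The Leibniz rule leaves two terms at \<open>p\<close>: one has the factor
    \<open>Y p = 0\<close>, the other the factor \<open>?h p = 0\<close>.\<close>
  then show ?thesis
    using nabla_scale_right[OF assms(1) smooth_fun_indicator[OF assms(1)] assms(3) Y assms(2)] assms(2,4)
    by simp
qed

text \<open>\<open>X\<close> is \<open>X'\<close> plus a difference that vanishes on
  \<open>U\<close>, and the latter contributes nothing.\<close>

lemma nabla_cong_left:
  assumes "open U" "p \<in> U" "smooth_vf M U X" "smooth_vf M U Y" "\<And>q. q \<in> U \<Longrightarrow> X q = X' q"
  shows "nabla X Y p = nabla X' Y p"
proof -
  have "smooth_vf M U X'" by (rule smooth_vf_cong[OF assms(1,3,5)])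
  moreover have "smooth_vf M U (\<lambda>q. X q - X' q)"
    by (rule smooth_vf_cong[OF assms(1) smooth_vf_zero[OF assms(1)]]) (simp add: assms(5))
  ultimately show ?thesis
    using nabla_add_left[OF assms(1), of X' "\<lambda>q. X q - X' q" Y p]
      nabla_zero_left[OF assms(1,2,4), of "\<lambda>q. X q - X' q"] assms by simp
qed

lemma nabla_cong_right:
  assumes "open U" "p \<in> U" "smooth_vf M U X" "smooth_vf M U Y" "\<And>q. q \<in> U \<Longrightarrow> Y q = Y' q"
  shows "nabla X Y p = nabla X Y' p"
proof -
  have "smooth_vf M U Y'" by (rule smooth_vf_cong[OF assms(1,4,5)])
  moreover have "smooth_vf M U (\<lambda>q. Y q - Y' q)"
    by (rule smooth_vf_cong[OF assms(1) smooth_vf_zero[OF assms(1)]]) (simp add: assms(5))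
  ultimately show ?thesis
    using nabla_add_right[OF assms(1), of X Y' "\<lambda>q. Y q - Y' q" p]
      nabla_zero_right[OF assms(1,2,3), of "\<lambda>q. Y q - Y' q"] assms by simp
qed

lemma nabla_sum_left:
  assumes "open U" "p \<in> U" "smooth_vf M U Y"
    and "\<And>i. i \<in> I \<Longrightarrow> smooth_fun M U (h i)" "\<And>i. i \<in> I \<Longrightarrow> smooth_vf M U (X i)"
  shows "nabla (\<lambda>q. \<Sum>i\<in>I. h i q *\<^sub>R X i q) Y p = (\<Sum>i\<in>I. h i p *\<^sub>R nabla (X i) Y p)"
  using assms(4,5)
proof (induction I rule: infinite_finite_induct)
  case (insert i I)
  then show ?case
    using nabla_add_left[OF assms(1), of "\<lambda>q. h i q *\<^sub>R X i q" "\<lambda>q. \<Sum>i\<in>I. h i q *\<^sub>R X i q" Y p]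
      nabla_scale_left[OF assms(1), of "h i" "X i" Y p]
    by (simp add: assms(1-3) smooth_vf_sum smooth_vf_scale)
qed (use nabla_zero_left[OF assms(1,2,3)] in auto)

end

section \<open>The product of a manifold with the real line\<close>

lemma smooth_on_fst_compose:
  "open S \<Longrightarrow> smooth_on S F \<Longrightarrow> smooth_on (S \<times> UNIV) (\<lambda>x. F (fst x))"
  by (rule smooth_on_compose[OF _ _ smooth_on_linear[OF _ linear_fst]]) (auto simp: open_Times)

lemma cdom_line_chart [simp]: "cdom (line_chart c) = cdom c \<times> UNIV"
  and cmap_line_chart [simp]: "cmap (line_chart c) = map_prod (cmap c) id"
  by (simp_all add: line_chart_def)

lemma atlas_line_product [simp]: "atlas (line_product M) = line_chart ` atlas M"
  and chart_at_line_product [simp]: "chart_at (line_product M) q = line_chart (chart_at M (fst q))"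
  by (simp_all add: line_product_def case_prod_beta)

lemma cmap_line_chart_image:
  "map_prod (cmap c) id ` (V \<times> UNIV \<inter> cdom c \<times> UNIV) = cmap c ` (V \<inter> cdom c) \<times> UNIV"
  "map_prod (cmap c) id ` (cdom c \<times> UNIV) = cmap c ` cdom c \<times> UNIV"
  by (rule set_eqI; force)+

section \<open>The product atlas\<close>

context manifold_loc
begin

text \<open>Injectivity of the chart pins down \<open>inv_into\<close> on the image; elsewhere its
  value is arbitrary, whence the condition on \<open>x\<close>.\<close>

lemma cinv_line_chart:
  assumes "c \<in> atlas M" "x \<in> cmap c ` cdom c"
  shows "cinv (line_chart c) (x, t) = (cinv c x, t)"
proof -
  have "inj_on (cmap c) (cdom c)"
    using cinv_cmap[OF assms(1)] by (rule inj_on_inverseI)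
  then have "inj_on (map_prod (cmap c) id) (cdom c \<times> (UNIV :: real set))"
    by (auto simp: inj_on_def)
  then show ?thesis
    using assms unfolding cinv_def[of "line_chart c"]
    by (auto intro!: inv_into_f_eq)
qed

lemma is_chart_line_chart:
  assumes "c \<in> atlas M"
  shows "is_chart (line_chart c)"
proof -
  have hom: "homeomorphism (cdom c) (cmap c ` cdom c) (cmap c) (cinv c)"
    and op: "open (cmap c ` cdom c)" "open (cdom c)"
    using is_chart[OF assms] by (auto simp: is_chart_def)
  have 1: "continuous_on (cdom c \<times> UNIV) (map_prod (cmap c) (id :: real \<Rightarrow> real))"
    unfolding map_prod_def case_prod_beta
    by (intro continuous_on_Pair continuous_on_compose2[OF homeomorphism_cont1[OF hom]])
      (auto intro!: continuous_intros)
  have "continuous_on (cmap c ` cdom c \<times> UNIV) (\<lambda>y. (cinv c (fst y), snd y :: real))"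
    by (intro continuous_on_Pair continuous_on_compose2[OF homeomorphism_cont2[OF hom]])
      (auto intro!: continuous_intros)
  then have 2: "continuous_on (cmap c ` cdom c \<times> UNIV) (cinv (line_chart c))"
    by (rule continuous_on_eq) (auto simp: cinv_line_chart assms)
  have "homeomorphism (cdom c \<times> UNIV) (cmap c ` cdom c \<times> UNIV) (map_prod (cmap c) id) (cinv (line_chart c))"
    by (rule homeomorphismI[OF 1 2]) (auto simp: cinv_line_chart assms)
  then show ?thesis
    by (simp add: is_chart_def cmap_line_chart_image op open_Times)
qed

lemma line_transition_eq:
  assumes "c \<in> atlas M" "d \<in> atlas M" "x \<in> cmap c ` (cdom c \<inter> cdom d) \<times> UNIV"
  shows "(cmap (line_chart d) \<circ> cinv (line_chart c)) x = ((cmap d \<circ> cinv c) (fst x), snd x)"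
  using assms by (cases x) (auto simp: cinv_line_chart)

lemma smooth_manifold_line_product: "smooth_manifold (line_product M)"
  unfolding smooth_manifold_def
proof (intro conjI ballI allI)
  fix c' d' assume "c' \<in> atlas (line_product M)" "d' \<in> atlas (line_product M)"
  then obtain c d where c: "c \<in> atlas M" "c' = line_chart c" and d: "d \<in> atlas M" "d' = line_chart d"
    by auto
  let ?S = "cmap c ` (cdom c \<inter> cdom d)"
  have S1: "open ?S"
    using open_chart_image[OF c(1) open_cdom[OF d(1)]] by (simp only: Int_commute[of "cdom d"])
  note S = S1 open_Times[OF S1 open_UNIV]
  have "smooth_on (?S \<times> UNIV) (\<lambda>x. ((cmap d \<circ> cinv c) (fst x), snd x))"
    by (intro smooth_on_Pair S smooth_on_fst_compose smooth_transition c d smooth_on_linear linear_snd)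
  then have "smooth_on (?S \<times> UNIV) (cmap (line_chart d) \<circ> cinv (line_chart c))"
    by (rule smooth_on_cong[OF S(2), rotated]) (simp only: line_transition_eq[OF c(1) d(1)])
  moreover have "cmap c' ` (cdom c' \<inter> cdom d') = ?S \<times> UNIV"
    unfolding c d cdom_line_chart cmap_line_chart by (rule set_eqI) force
  ultimately show "smooth_on (cmap c' ` (cdom c' \<inter> cdom d')) (cmap d' \<circ> cinv c')"
    by (simp add: c d)
qed (auto simp: is_chart_line_chart mem_Times_iff)

end

section \<open>Horizontal and line components, and lifts from the base\<close>

locale line_loc = manifold_loc M
  for M :: "('m::{t2_space, second_countable_topology}, 'e::euclidean_space) manifold"
begin

sublocale line: manifold_loc "line_product M"
  by unfold_locales (rule smooth_manifold_line_product)

text \<open>Transitions of the product are those of the base times the identity of the line, hence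
  have block diagonal Jacobians.\<close>

lemma line_transition_deriv:
  assumes "c \<in> atlas M" "d \<in> atlas M" "fst q \<in> cdom c" "fst q \<in> cdom d"
  shows "transition_deriv (line_chart c) (line_chart d) q v = (transition_deriv c d (fst q) (fst v), snd v)"
proof -
  let ?S = "cmap c ` (cdom c \<inter> cdom d)"
  have S: "open (?S \<times> (UNIV :: real set))"
    using open_chart_image[OF assms(1) open_cdom[OF assms(2)]] by (auto simp: Int_commute intro!: open_Times)
  have q: "cmap (line_chart c) q \<in> ?S \<times> UNIV"
    using assms by (auto simp: mem_Times_iff)
  have "((\<lambda>x. (cmap d \<circ> cinv c) (fst x)) has_derivative (\<lambda>v. transition_deriv c d (fst q) (fst v)))
      (at (cmap (line_chart c) q))"
    by (rule has_derivative_compose[OF bounded_linear_imp_has_derivative[OF bounded_linear_fst]])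
      (use has_derivative_transition[OF assms] in \<open>simp add: o_def\<close>)
  then have "((\<lambda>x. ((cmap d \<circ> cinv c) (fst x), snd x)) has_derivative
      (\<lambda>v. (transition_deriv c d (fst q) (fst v), snd v))) (at (cmap (line_chart c) q))"
    by (intro has_derivative_Pair has_derivative_snd has_derivative_ident)
  then have "(cmap (line_chart d) \<circ> cinv (line_chart c) has_derivative
      (\<lambda>v. (transition_deriv c d (fst q) (fst v), snd v))) (at (cmap (line_chart c) q))"
    by (rule has_derivative_transform_within_open[OF _ S q]) (simp only: line_transition_eq[OF assms(1,2)])
  from fun_cong[OF frechet_derivative_at[OF this], of v] show ?thesis
    by (simp add: transition_deriv_def)
qed

lemma components_line_chart:
  "c \<in> atlas M \<Longrightarrow> fst q \<in> cdom c \<Longrightarrow>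
    components (line_product M) (line_chart c) q v = (components M c (fst q) (fst v), snd v)"
  by (simp add: components_eq line_transition_deriv)

lemma coord_field_line_chart:
  "c \<in> atlas M \<Longrightarrow> fst q \<in> cdom c \<Longrightarrow>
    coord_field (line_product M) (line_chart c) v q = (coord_field M c (fst v) (fst q), snd v)"
  by (simp add: coord_field_def line_transition_deriv)

lemma smooth_vf_lineI:
  assumes "open U"
    and "\<And>c. c \<in> atlas M \<Longrightarrow> smooth_on (map_prod (cmap c) id ` (U \<inter> cdom c \<times> UNIV)) (F c)"
    and "\<And>c p t. c \<in> atlas M \<Longrightarrow> (p, t) \<in> U \<Longrightarrow> p \<in> cdom c \<Longrightarrow>
      F c (cmap c p, t) = (components M c p (fst (X (p, t))), snd (X (p, t)))"
  shows "smooth_vf (line_product M) U X"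
  unfolding smooth_vf_def
proof
  fix c' assume c': "c' \<in> atlas (line_product M)"
  then obtain c where c: "c \<in> atlas M" "c' = line_chart c" by auto
  show "smooth_on (cmap c' ` (U \<inter> cdom c')) (\<lambda>x. components (line_product M) c' (cinv c' x) (X (cinv c' x)))"
  proof (rule smooth_on_cong[OF line.open_chart_image[OF c' assms(1)]])
    show "smooth_on (cmap c' ` (U \<inter> cdom c')) (F c)"
      using assms(2)[OF c(1)] by (simp add: c)
  qed (use c c' assms(3)[OF c(1)] in \<open>auto simp: cinv_line_chart components_line_chart\<close>)
qed

lemma smooth_fun_lineI:
  assumes "open U"
    and "\<And>c. c \<in> atlas M \<Longrightarrow> smooth_on (map_prod (cmap c) id ` (U \<inter> cdom c \<times> UNIV)) (F c)"
    and "\<And>c p t. c \<in> atlas M \<Longrightarrow> (p, t) \<in> U \<Longrightarrow> p \<in> cdom c \<Longrightarrow> F c (cmap c p, t) = h (p, t)"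
  shows "smooth_fun (line_product M) U h"
  unfolding smooth_fun_def
proof
  fix c' assume c': "c' \<in> atlas (line_product M)"
  then obtain c where c: "c \<in> atlas M" "c' = line_chart c" by auto
  show "smooth_on (cmap c' ` (U \<inter> cdom c')) (h \<circ> cinv c')"
  proof (rule smooth_on_cong[OF line.open_chart_image[OF c' assms(1)]])
    show "smooth_on (cmap c' ` (U \<inter> cdom c')) (F c)"
      using assms(2)[OF c(1)] by (simp add: c)
  qed (use c c' assms(3)[OF c(1)] in \<open>auto simp: cinv_line_chart\<close>)
qed

lemma open_line_chart_image:
  "c \<in> atlas M \<Longrightarrow> open (U :: ('m \<times> real) set) \<Longrightarrow> open (map_prod (cmap c) id ` (U \<inter> cdom c \<times> UNIV))"
  using line.open_chart_image[of "line_chart c" U] by simp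

lemma smooth_vf_lift:
  assumes "open V" "smooth_vf M V Z"
  shows "smooth_vf (line_product M) (V \<times> UNIV) (\<lambda>q. (Z (fst q), 0))"
proof (rule smooth_vf_lineI)
  fix c assume c: "c \<in> atlas M"
  show "smooth_on (map_prod (cmap c) id ` (V \<times> UNIV \<inter> cdom c \<times> UNIV))
      (\<lambda>x. (components M c (cinv c (fst x)) (Z (cinv c (fst x))), 0 :: real))"
    unfolding cmap_line_chart_image
    by (intro smooth_on_Pair smooth_on_fst_compose[OF _ smooth_vfD[OF assms(2) c]] smooth_on_const
        open_Times open_UNIV open_chart_image[OF c assms(1)])
qed (use assms in \<open>auto simp: open_Times\<close>)

lemma smooth_fun_lift:
  assumes "open V" "smooth_fun M V h"
  shows "smooth_fun (line_product M) (V \<times> UNIV) (\<lambda>q. h (fst q))"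
proof (rule smooth_fun_lineI)
  fix c assume c: "c \<in> atlas M"
  show "smooth_on (map_prod (cmap c) id ` (V \<times> UNIV \<inter> cdom c \<times> UNIV)) (\<lambda>x. h (cinv c (fst x)))"
    unfolding cmap_line_chart_image
    by (intro smooth_on_fst_compose[OF _ smooth_funD[OF assms(2) c]] open_chart_image[OF c assms(1)])
qed (use assms in \<open>auto simp: open_Times\<close>)

lemma smooth_fun_snd: "smooth_fun (line_product M) UNIV snd"
  by (rule smooth_fun_lineI[where F = "\<lambda>_. snd"])
    (auto intro!: smooth_on_linear linear_snd dest: open_line_chart_image[OF _ open_UNIV])

lemma smooth_vf_line_direction: "smooth_vf (line_product M) UNIV (\<lambda>q. (0, 1))"
  by (rule smooth_vf_lineI[where F = "\<lambda>_ _. (0, 1)"])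
    (auto intro!: smooth_on_const simp: linear_0[OF linear_components] dest: open_line_chart_image[OF _ open_UNIV])

text \<open>The line component of a vector is the same in every product chart, so it is a linear
  projection of the smooth chart components.\<close>

lemma smooth_fun_snd_field:
  assumes "open U" "smooth_vf (line_product M) U X"
  shows "smooth_fun (line_product M) U (\<lambda>q. snd (X q))"
proof (rule smooth_fun_lineI[OF assms(1)])
  fix c assume c: "c \<in> atlas M"
  let ?c = "line_chart c"
  show "smooth_on (map_prod (cmap c) id ` (U \<inter> cdom c \<times> UNIV))
      (\<lambda>x. snd (components (line_product M) ?c (cinv ?c x) (X (cinv ?c x))))"
    using line.smooth_vfD[OF assms(2), of ?c] c
    by (intro smooth_on_linear_compose[OF open_line_chart_image[OF c assms(1)] linear_snd]) auto
qed (auto simp: cinv_line_chart components_line_chart)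

text \<open>In coordinates this is composition with the embedding \<open>x \<mapsto> (x, t)\<close>
  followed by a projection. It serves to recover a base field from a field on the product.\<close>

lemma smooth_vf_slice:
  assumes "smooth_vf (line_product M) UNIV X"
  shows "smooth_vf M UNIV (\<lambda>p. fst (X (p, t)))"
proof (rule smooth_vfI)
  fix c assume c: "c \<in> atlas M"
  let ?c = "line_chart c"
  let ?S = "cmap c ` (UNIV \<inter> cdom c)"
  let ?G = "\<lambda>x. components (line_product M) ?c (cinv ?c x) (X (cinv ?c x))"
  have S: "open ?S" by (rule open_chart_image[OF c open_UNIV])
  have "smooth_on (?S \<times> UNIV) ?G"
    using line.smooth_vfD[OF assms, of ?c] c by (simp add: cmap_line_chart_image)
  moreover have "smooth_on ?S (\<lambda>x. (x, t))"
    by (intro smooth_on_Pair S smooth_on_linear[OF S linear_ident] smooth_on_const)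
  ultimately have "smooth_on ?S (\<lambda>x. ?G (x, t))"
    by (rule smooth_on_compose[OF S]) auto
  then show "smooth_on ?S (\<lambda>x. fst (?G (x, t)))"
    by (rule smooth_on_linear_compose[OF S linear_fst])
qed (auto simp: cinv_line_chart components_line_chart)

text \<open>\<open>dir_deriv\<close> uses a field only through its value at the point, so the
  horizontal part can be passed as a constant function; the rest is the chain rule for the
  projection to the base.\<close>

lemma dir_deriv_lift:
  assumes "open V" "smooth_fun M V h" "fst q \<in> V"
  shows "dir_deriv (line_product M) X (\<lambda>q. h (fst q)) q = dir_deriv M (\<lambda>_. fst (X q)) h (fst q)"
proof -
  obtain p t where q: "q = (p, t)" by (cases q)
  let ?c = "chart_at M p"
  let ?D = "frechet_derivative (h \<circ> cinv ?c) (at (cmap ?c p))"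
  have "h \<circ> cinv ?c differentiable (at (cmap ?c p))"
    using smooth_on_differentiable[OF smooth_funD[OF assms(2) chart_at_atlas[of p]], of "cmap ?c p"] assms(3)
    by (auto simp: q o_def)
  then have "(h \<circ> cinv ?c has_derivative ?D) (at (fst (cmap ?c p, t)))"
    by (simp add: frechet_derivative_works[symmetric])
  then have "((\<lambda>x. (h \<circ> cinv ?c) (fst x)) has_derivative (\<lambda>v. ?D (fst v))) (at (cmap ?c p, t))"
    by (rule has_derivative_compose[OF bounded_linear_imp_has_derivative[OF bounded_linear_fst]])
  then have "((\<lambda>q. h (fst q)) \<circ> cinv (line_chart ?c) has_derivative (\<lambda>v. ?D (fst v))) (at (cmap ?c p, t))"
    by (rule has_derivative_transform_within_open[OF _
          open_Times[OF open_chart_image[OF chart_at_atlas open_UNIV] open_UNIV]])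
      (auto simp: cinv_line_chart)
  from fun_cong[OF frechet_derivative_at[OF this], of "X q"] show ?thesis
    by (simp add: dir_deriv_def q)
qed

lemma dir_deriv_snd: "dir_deriv (line_product M) X snd q = snd (X q)"
proof -
  obtain p t where q: "q = (p, t)" by (cases q)
  let ?c = "chart_at M p"
  have "(snd has_derivative snd) (at (cmap ?c p, t))"
    by (rule bounded_linear_imp_has_derivative[OF bounded_linear_snd])
  then have "(snd \<circ> cinv (line_chart ?c) has_derivative snd) (at (cmap ?c p, t))"
    by (rule has_derivative_transform_within_open[OF _
          open_Times[OF open_chart_image[OF chart_at_atlas open_UNIV] open_UNIV]])
      (auto simp: cinv_line_chart)
  from fun_cong[OF frechet_derivative_at[OF this], of "X q"] show ?thesis
    by (simp add: dir_deriv_def q)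
qed

text \<open>A coordinate is linear in its own chart, so differentiating it reads off a component.
  This turns torsion identities, stated through test functions, into identities of vectors.\<close>

lemma dir_deriv_coord:
  assumes "c \<in> atlas M" "p \<in> cdom c"
  shows "dir_deriv M X (\<lambda>p. cmap c p \<bullet> b) p = components M c p (X p) \<bullet> b"
proof -
  have "((\<lambda>x. x \<bullet> b) has_derivative (\<lambda>v. v \<bullet> b)) (at (cmap c p))"
    by (intro bounded_linear_imp_has_derivative bounded_linear_inner_left)
  then have "((\<lambda>p. cmap c p \<bullet> b) \<circ> cinv c has_derivative (\<lambda>v. v \<bullet> b)) (at (cmap c p))"
    by (rule has_derivative_transform_within_open[OF _ open_chart_image[OF assms(1) open_UNIV]])
      (use assms in auto)
  from fun_cong[OF frechet_derivative_at[OF this], of "components M c p (X p)"]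
  show ?thesis
    using dir_deriv_chart[OF smooth_fun_coord[OF assms(1)] assms(1,2,2) open_cdom[OF assms(1)]] by simp
qed

end

section \<open>Orthonormal bases of a bilinear form\<close>

text \<open>Pairing a vanishing combination with \<open>e j\<close> isolates its coefficient, so the
  \<open>e i\<close> are independent and, by their number, span the space. The vectors satisfying
  the expansion form a subspace containing all \<open>e i\<close>.\<close>

lemma orthonormal_expansion:
  fixes B :: "'a::euclidean_space \<Rightarrow> 'a \<Rightarrow> real" and e :: "nat \<Rightarrow> 'a"
  assumes "bilinear B"
    and orth: "\<And>i j. i < DIM('a) \<Longrightarrow> j < DIM('a) \<Longrightarrow> B (e i) (e j) = (if i = j then 1 else 0)"
  shows "(\<Sum>i<DIM('a). B (e i) v *\<^sub>R e i) = v"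
proof -
  have lin: "linear (B x)" for x
    using assms(1) by (simp add: bilinear_def)
  let ?I = "{..<DIM('a)}"
  let ?S = "{v. (\<Sum>i\<in>?I. B (e i) v *\<^sub>R e i) = v}"
  have inj: "inj_on e ?I"
    by (rule inj_onI) (use orth in \<open>metis lessThan_iff zero_neq_one\<close>)
  have indep: "independent (e ` ?I)"
  proof
    assume "dependent (e ` ?I)"
    then obtain u j where j: "j \<in> ?I" "u (e j) \<noteq> 0" and "(\<Sum>x\<in>e ` ?I. u x *\<^sub>R x) = 0"
      by (auto simp: dependent_finite)
    then have "B (e j) (\<Sum>i\<in>?I. u (e i) *\<^sub>R e i) = 0"
      using sum.reindex[OF inj, of "\<lambda>x. u x *\<^sub>R x"] by (simp add: linear_0[OF lin])
    moreover have "B (e j) (\<Sum>i\<in>?I. u (e i) *\<^sub>R e i) = (\<Sum>i\<in>?I. u (e i) * B (e j) (e i))"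
      by (simp add: linear_sum[OF lin] linear_scale[OF lin])
    moreover have "\<dots> = (\<Sum>i\<in>?I. if j = i then u (e j) else 0)"
      by (rule sum.cong) (use orth j(1) in auto)
    ultimately show False using j by simp
  qed
  have "subspace ?S"
    by (auto simp: subspace_def linear_0[OF lin] linear_add[OF lin] linear_scale[OF lin]
        scaleR_add_left sum.distrib scaleR_sum_right[symmetric] simp flip: scaleR_scaleR)
  moreover have "e ` ?I \<subseteq> ?S"
  proof safe
    fix j assume j: "j < DIM('a)"
    have "(\<Sum>i\<in>?I. B (e i) (e j) *\<^sub>R e i) = (\<Sum>i\<in>?I. if i = j then e j else 0)"
      by (rule sum.cong) (use orth j in auto)
    then show "(\<Sum>i\<in>?I. B (e i) (e j) *\<^sub>R e i) = e j" using j by simp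
  qed
  ultimately have "span (e ` ?I) \<subseteq> ?S" by (rule span_minimal[rotated])
  moreover have "UNIV \<subseteq> span (e ` ?I)"
    by (rule card_ge_dim_independent[OF _ indep]) (simp_all add: card_image[OF inj])
  ultimately show ?thesis by blast
qed

section \<open>The Reeb field of a warped product\<close>

text \<open>The derivative is linear in the vector because \<open>h\<close> is differentiable at the
  point.\<close>

lemma (in manifold_loc) dir_deriv_zero:
  assumes "smooth_fun M V h" "p \<in> V" "X p = 0"
  shows "dir_deriv M X h p = 0"
proof -
  let ?c = "chart_at M p"
  have "h \<circ> cinv ?c differentiable (at (cmap ?c p))"
    using smooth_on_differentiable[OF smooth_funD[OF assms(1) chart_at_atlas[of p]], of "cmap ?c p"] assms(2)
    by (auto simp: o_def)
  then show ?thesis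
    by (simp add: dir_deriv_def assms(3) linear_0[OF linear_frechet_derivative])
qed

lemma warped_metric_eq:
  "warped_metric g f q v w = g (fst q) (fst v) (fst w) + (f (fst q))\<^sup>2 * (snd v * snd w)"
  by (simp add: warped_metric_def case_prod_beta)

lemma warped_reeb_eq: "warped_reeb f q = (0, inverse (f (fst q)))"
  by (simp add: warped_reeb_def case_prod_beta)

lemma warped_phi_eq: "warped_phi J q v = (J (fst q) (fst v), 0)"
  by (simp add: warped_phi_def case_prod_beta)

section \<open>The warped metric and the defining identities of its Levi-Civita connection\<close>

locale warped_loc = line_loc M
  for M :: "('m::{t2_space, second_countable_topology}, 'e::euclidean_space) manifold" +
  fixes g :: "'m \<Rightarrow> 'e \<Rightarrow> 'e \<Rightarrow> real"
    and J :: "'m \<Rightarrow> 'e \<Rightarrow> 'e"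
    and f :: "'m \<Rightarrow> real"
    and nabla :: "('m \<times> real, 'e \<times> real) connection"
  assumes metric: "riemannian_metric M g"
    and endo: "smooth_endomorphism M J"
    and f_smooth: "smooth_fun M UNIV f"
    and f_pos: "\<And>p. f p > 0"
    and lc: "levi_civita (line_product M) (warped_metric g f) nabla"
begin

sublocale line: connection_loc "line_product M" nabla
  by unfold_locales (use lc in \<open>simp add: levi_civita_def\<close>)

abbreviation "N \<equiv> line_product M"
abbreviation "G \<equiv> warped_metric g f"
abbreviation "\<xi> \<equiv> warped_reeb f :: 'm \<times> real \<Rightarrow> 'e \<times> real"
abbreviation "lift Z \<equiv> (\<lambda>q::'m \<times> real. (Z (fst q) :: 'e, 0 :: real))"

definition "K = nabla \<xi> \<xi>"

lemma f_nonzero [simp]: "f p \<noteq> 0"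
  using f_pos[of p] by simp

lemma g_bilinear: "bilinear (g p)"
  and g_sym: "g p v w = g p w v"
  and g_pos: "v \<noteq> 0 \<Longrightarrow> g p v v > 0"
  and g_smooth: "open U \<Longrightarrow> smooth_vf M U X \<Longrightarrow> smooth_vf M U Y \<Longrightarrow> smooth_fun M U (\<lambda>p. g p (X p) (Y p))"
  using metric by (auto simp: riemannian_metric_def)

lemma g_zero [simp]: "g p 0 w = 0" "g p v 0 = 0"
  by (simp_all add: bilinear_lzero[OF g_bilinear] bilinear_rzero[OF g_bilinear])

lemma G_bilinear: "bilinear (G q)"
  unfolding bilinear_def
  by (intro conjI allI linearI)
    (simp_all add: warped_metric_eq bilinear_ladd[OF g_bilinear] bilinear_radd[OF g_bilinear]
      bilinear_lmul[OF g_bilinear] bilinear_rmul[OF g_bilinear] algebra_simps)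

text \<open>The dual form of the Reeb field is \<open>f dt\<close>: the square of \<open>f\<close>
  in the metric meets the factor \<open>1/f\<close> of the field.\<close>

lemma G_reeb: "G q (\<xi> q) v = f (fst q) * snd v" "G q v (\<xi> q) = f (fst q) * snd v"
  by (simp_all add: warped_metric_eq warped_reeb_eq power2_eq_square)

lemma J_linear: "linear (J p)"
  and J_smooth: "open U \<Longrightarrow> smooth_vf M U X \<Longrightarrow> smooth_vf M U (\<lambda>p. J p (X p))"
  using endo by (auto simp: smooth_endomorphism_def)

lemma smooth_inverse_f: "smooth_fun M UNIV (\<lambda>p. inverse (f p))"
  by (rule smooth_fun_inverse[OF open_UNIV f_smooth]) simp

lemma smooth_f_lift: "smooth_fun N U (\<lambda>q. f (fst q))"
  using smooth_fun_subset[OF smooth_fun_lift[OF open_UNIV f_smooth]] by simp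

lemma smooth_reeb: "smooth_vf N U \<xi>"
proof -
  have "smooth_fun N UNIV (\<lambda>q. inverse (f (fst q)))"
    using smooth_fun_lift[OF open_UNIV smooth_inverse_f] by simp
  from line.smooth_vf_scale[OF open_UNIV this smooth_vf_line_direction]
  have "smooth_vf N UNIV \<xi>"
    by (simp add: warped_reeb_eq[abs_def])
  then show ?thesis by (rule smooth_vf_subset) simp
qed

lemma metric_compat:
  assumes "open U" "smooth_vf N U X" "smooth_vf N U Y" "smooth_vf N U Z" "q \<in> U"
  shows "dir_deriv N X (\<lambda>q. G q (Y q) (Z q)) q = G q (nabla X Y q) (Z q) + G q (Y q) (nabla X Z q)"
  using lc[unfolded levi_civita_def metric_connection_def, THEN conjunct2, THEN conjunct2, rule_format]
    assms by blast

text \<open>Metric compatibility with vanishing left side. It is applied to the inner product of the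
  Reeb field with itself, which is 1, and with horizontal fields, which is 0.\<close>

lemma metric_compat_const:
  assumes "open U" "smooth_vf N U X" "smooth_vf N U Y" "smooth_vf N U Z" "q \<in> U"
    and "\<And>q. q \<in> U \<Longrightarrow> G q (Y q) (Z q) = k"
  shows "G q (nabla X Y q) (Z q) = - G q (Y q) (nabla X Z q)"
  using metric_compat[OF assms(1-5)] line.dir_deriv_const[OF assms(1,5), of "\<lambda>q. G q (Y q) (Z q)" k X]
    assms(6) by simp

lemma torsion:
  assumes "open U" "smooth_vf N U X" "smooth_vf N U Y" "smooth_fun N U h" "q \<in> U"
  shows "dir_deriv N (\<lambda>q. nabla X Y q - nabla Y X q) h q
    = dir_deriv N X (dir_deriv N Y h) q - dir_deriv N Y (dir_deriv N X h) q"
  using lc[unfolded levi_civita_def torsion_free_def, THEN conjunct2, THEN conjunct1, rule_format]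
    assms by blast

text \<open>The torsion identity tested on the coordinate \<open>t\<close>, whose derivative along a
  field is the line component of that field.\<close>

lemma torsion_snd:
  assumes "open U" "smooth_vf N U X" "smooth_vf N U Y" "q \<in> U"
  shows "snd (nabla X Y q) - snd (nabla Y X q)
    = dir_deriv N X (\<lambda>q. snd (Y q)) q - dir_deriv N Y (\<lambda>q. snd (X q)) q"
  using torsion[OF assms(1-3) smooth_fun_subset[OF smooth_fun_snd subset_UNIV] assms(4)]
  by (simp add: dir_deriv_snd[abs_def])

text \<open>The bracket of the Reeb field with a lifted field is vertical.\<close>

lemma torsion_fst_reeb_lift:
  assumes "open V" "smooth_vf M V Z" "fst q \<in> V"
  shows "fst (nabla \<xi> (lift Z) q) = fst (nabla (lift Z) \<xi> q)"
proof -
  let ?c = "chart_at M (fst q)"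
  let ?V = "V \<inter> cdom ?c"
  let ?U = "?V \<times> (UNIV :: real set)"
  have V: "open ?V" "open ?U" "q \<in> ?U"
    using assms by (auto simp: mem_Times_iff intro!: open_Times)
  have Z: "smooth_vf N ?U (lift Z)"
    by (rule smooth_vf_lift[OF V(1) smooth_vf_subset[OF assms(2)]]) simp
  have "fst (nabla \<xi> (lift Z) q - nabla (lift Z) \<xi> q) \<bullet> b = 0" for b
  proof -
    \<comment> \<open>Lifted base coordinates serve as test functions. They come from the preferred
      chart at \<open>fst q\<close>, so at \<open>q\<close> they give the horizontal components
      themselves.\<close>
    let ?h = "\<lambda>p. cmap ?c p \<bullet> b"
    have coord: "smooth_fun M (cdom ?c) ?h"
      by (rule smooth_fun_coord) simp
    have h: "smooth_fun N ?U (\<lambda>q. ?h (fst q))"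
      by (rule smooth_fun_lift[OF V(1) smooth_fun_subset[OF coord]]) simp
    have d: "dir_deriv N X (\<lambda>q. ?h (fst q)) r = components M ?c (fst r) (fst (X r)) \<bullet> b"
      if "r \<in> ?U" for X r
      using that dir_deriv_lift[OF _ coord, of r X] dir_deriv_coord[of ?c "fst r"] by auto
    \<comment> \<open>Differentiating along \<open>lift Z\<close> gives a function of the base point
      alone, which the vertical Reeb field annihilates.\<close>
    have "dir_deriv N \<xi> (dir_deriv N (lift Z) (\<lambda>q. ?h (fst q))) q
        = dir_deriv N \<xi> (\<lambda>q. components M ?c (fst q) (Z (fst q)) \<bullet> b) q"
      by (rule line.dir_deriv_cong[OF V(2,3)]) (simp add: d)
    also have "\<dots> = 0"
    proof -
      have "smooth_fun M ?V (\<lambda>p. components M ?c p (Z p) \<bullet> b)"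
        by (rule smooth_fun_component) (use assms in auto)
      then show ?thesis
        using dir_deriv_lift[OF V(1), of _ q \<xi>] dir_deriv_zero[of ?V _ "fst q"] V(3)
        by (simp add: mem_Times_iff warped_reeb_eq)
    qed
    finally have 1: "dir_deriv N \<xi> (dir_deriv N (lift Z) (\<lambda>q. ?h (fst q))) q = 0" .
    \<comment> \<open>Here the Reeb field already annihilates the lifted coordinate on all of
      \<open>?U\<close>.\<close>
    have 2: "dir_deriv N (lift Z) (dir_deriv N \<xi> (\<lambda>q. ?h (fst q))) q = 0"
      by (rule line.dir_deriv_const[OF V(2,3), where k = 0])
        (auto simp: d warped_reeb_eq linear_0[OF linear_components])
    show ?thesis
      using torsion[OF V(2) smooth_reeb Z h V(3)] d[OF V(3)] 1 2 by simp
  qed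
  \<comment> \<open>Taking \<open>b\<close> to be the vector itself makes its Euclidean norm
    vanish.\<close>
  from this[of "fst (nabla \<xi> (lift Z) q - nabla (lift Z) \<xi> q)"] show ?thesis by simp
qed

text \<open>A field of constant length is orthogonal to its derivatives, and orthogonal to the Reeb
  field means horizontal.\<close>

lemma snd_nabla_reeb:
  assumes "open U" "smooth_vf N U X" "q \<in> U"
  shows "snd (nabla X \<xi> q) = 0"
  using metric_compat_const[OF assms(1,2) smooth_reeb smooth_reeb assms(3), of 1]
  by (simp add: G_reeb) (simp add: warped_reeb_eq)

text \<open>On horizontal vectors the form \<open>G (nabla Z \<xi>) W\<close> is skew, because the
  metric on lifts does not change along the Reeb field, and symmetric, because brackets of lifts are
  horizontal. Hence it is zero.\<close>

lemma nabla_lift_reeb: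
  assumes "open V" "smooth_vf M V Z" "fst q \<in> V"
  shows "nabla (lift Z) \<xi> q = 0"
proof -
  let ?c = "chart_at M (fst q)"
  let ?w = "fst (nabla (lift Z) \<xi> q)"
  \<comment> \<open>A field extending the vector \<open>?w\<close> to a neighbourhood, so that the
    form evaluated on it yields the square length of \<open>?w\<close>.\<close>
  let ?W = "coord_field M ?c ?w"
  let ?V = "V \<inter> cdom ?c"
  let ?U = "?V \<times> (UNIV :: real set)"
  have V: "open ?V" "open ?U" "q \<in> ?U" "fst q \<in> ?V"
    using assms by (auto simp: mem_Times_iff intro!: open_Times)
  have sm: "smooth_vf M ?V Z" "smooth_vf M ?V ?W"
    by (rule smooth_vf_subset[OF assms(2)], simp)
      (rule smooth_vf_subset[OF smooth_coord_field], simp_all)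
  note lift = sm[THEN smooth_vf_lift[OF V(1)]]
  note br = sm[THEN torsion_fst_reeb_lift[OF V(1) _ V(4)]]
  have G_lift: "G q (nabla X \<xi> q) (lift Y q) = - G q (\<xi> q) (nabla X (lift Y) q)"
    if "smooth_vf N ?U X" "smooth_vf N ?U (lift Y)" for X Y
    by (rule metric_compat_const[OF V(2) that(1) smooth_reeb that(2) V(3), where k = 0]) (simp add: G_reeb)
  \<comment> \<open>Skewness: the inner product of two lifts depends on the base point only. After
    metric compatibility, \<open>br\<close> exchanges the Reeb field with the lifts in horizontal
    parts.\<close>
  have "dir_deriv N \<xi> (\<lambda>q. G q (lift Z q) (lift ?W q)) q = 0"
    using dir_deriv_lift[OF V(1) g_smooth[OF V(1) sm] V(4), of \<xi>] dir_deriv_zero[OF g_smooth[OF V(1) sm] V(4)]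
    by (simp add: warped_metric_eq warped_reeb_eq)
  then have "G q (nabla \<xi> (lift Z) q) (lift ?W q) + G q (lift Z q) (nabla \<xi> (lift ?W) q) = 0"
    using metric_compat[OF V(2) smooth_reeb lift V(3)] by simp
  then have "G q (nabla (lift Z) \<xi> q) (lift ?W q) + G q (nabla (lift ?W) \<xi> q) (lift Z q) = 0"
    by (simp add: warped_metric_eq br g_sym[of _ "Z (fst q)"])
  \<comment> \<open>Symmetry: lifts have line component zero, so their bracket has none either;
    \<open>G_lift\<close> carries this over to the form.\<close>
  moreover have "snd (nabla (lift Z) (lift ?W) q) = snd (nabla (lift ?W) (lift Z) q)"
    using torsion_snd[OF V(2) lift V(3)] by (simp add: line.dir_deriv_const[OF V(2,3)])
  ultimately have "G q (nabla (lift Z) \<xi> q) (lift ?W q) = 0"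
    using G_lift[OF lift] G_lift[OF lift(2,1)] by (simp add: G_reeb)
  then have "?w = 0"
    using g_pos[of ?w "fst q"] by (auto simp: warped_metric_eq)
  moreover have "snd (nabla (lift Z) \<xi> q) = 0"
    by (rule snd_nabla_reeb[OF V(2) lift(1) V(3)])
  ultimately show ?thesis by (simp add: prod_eq_iff)
qed

lemma fst_nabla_reeb_lift:
  assumes "open V" "smooth_vf M V Z" "fst q \<in> V"
  shows "fst (nabla \<xi> (lift Z) q) = 0"
  by (simp add: torsion_fst_reeb_lift[OF assms] nabla_lift_reeb[OF assms])

text \<open>Both sides are linear over functions in \<open>X\<close>, so \<open>X\<close> is
  expanded in coordinate fields of a product chart. The horizontal ones are lifts and contribute
  nothing.\<close>

lemma nabla_reeb:
  assumes "open U" "smooth_vf N U X" "q \<in> U"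
  shows "nabla X \<xi> q = (f (fst q) * snd (X q)) *\<^sub>R K q"
proof -
  let ?c = "chart_at M (fst q)"
  let ?d = "line_chart ?c"
  let ?D = "cdom ?c \<times> (UNIV :: real set)"
  let ?U = "U \<inter> ?D"
  let ?Y = "coord_field N ?d"
  have D: "open ?D" "q \<in> ?D" "?d \<in> atlas N" by (auto simp: mem_Times_iff intro!: open_Times)
  then have U: "open ?U" "q \<in> ?U" using assms by auto
  have X: "smooth_vf N ?U X" by (rule smooth_vf_subset[OF assms(2)]) simp
  have "nabla X \<xi> q = nabla (\<lambda>q. \<Sum>b\<in>Basis. (components N ?d q (X q) \<bullet> b) *\<^sub>R ?Y b q) \<xi> q"
    by (rule line.nabla_cong_left[OF U X smooth_reeb]) (rule line.coord_field_expansion, use D in auto)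
  also have "\<dots> = (\<Sum>b\<in>Basis. (components N ?d q (X q) \<bullet> b) *\<^sub>R nabla (?Y b) \<xi> q)"
  proof (rule line.nabla_sum_left[OF U smooth_reeb])
    show "smooth_fun N ?U (\<lambda>q. components N ?d q (X q) \<bullet> b)" for b
      using line.smooth_fun_component[OF assms(1) D(3) assms(2)] by simp
    show "smooth_vf N ?U (?Y b)" for b
      by (rule smooth_vf_subset[OF line.smooth_coord_field[OF D(3)]]) simp
  qed
  also have "components N ?d q (X q) = X q"
    using line.components_chart_at[of q] by simp
  also have "(\<Sum>b\<in>Basis. (X q \<bullet> b) *\<^sub>R nabla (?Y b) \<xi> q) = (f (fst q) * snd (X q)) *\<^sub>R K q"
  proof -
    have Y: "smooth_vf N ?D (?Y b)" for b
      using line.smooth_coord_field[OF D(3)] by simp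
    have "nabla (?Y (u, 0)) \<xi> q = 0" for u
    proof -
      have "nabla (?Y (u, 0)) \<xi> q = nabla (lift (coord_field M ?c u)) \<xi> q"
        by (rule line.nabla_cong_left[OF D(1,2) Y smooth_reeb]) (auto simp: coord_field_line_chart)
      also have "\<dots> = 0"
        by (rule nabla_lift_reeb[OF _ smooth_coord_field]) auto
      finally show ?thesis .
    qed
    \<comment> \<open>The remaining coordinate field is the one along the line, which equals
      \<open>f\<close> times the Reeb field.\<close>
    moreover have "nabla (?Y (0, 1)) \<xi> q = f (fst q) *\<^sub>R K q"
    proof -
      have "nabla (?Y (0, 1)) \<xi> q = nabla (\<lambda>q. f (fst q) *\<^sub>R \<xi> q) \<xi> q"
        by (rule line.nabla_cong_left[OF D(1,2) Y smooth_reeb])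
          (auto simp: coord_field_line_chart linear_0[OF linear_coord_field] warped_reeb_eq)
      also have "\<dots> = f (fst q) *\<^sub>R K q"
        unfolding K_def
        by (rule line.nabla_scale_left[OF open_UNIV smooth_f_lift smooth_reeb smooth_reeb UNIV_I])
      finally show ?thesis .
    qed
    ultimately show ?thesis
      by (simp add: sum_Basis_prod_eq mult.commute) (simp add: inner_prod_def)
  qed
  finally show ?thesis .
qed

section \<open>The field \<open>K\<close>, its descent to the base and its derivative along the Reeb
  field\<close>

lemma snd_K [simp]: "snd (K q) = 0"
  unfolding K_def by (rule snd_nabla_reeb[OF open_UNIV smooth_reeb UNIV_I])

lemma smooth_K: "smooth_vf N U K"
  unfolding K_def
  by (rule smooth_vf_subset[OF line.smooth_nabla[OF open_UNIV smooth_reeb smooth_reeb]]) simp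

text \<open>In fact \<open>K = - grad (ln f)\<close>.\<close>

lemma g_K: "g (fst q) (fst (K q)) w = f (fst q) * dir_deriv M (\<lambda>_. w) (\<lambda>p. inverse (f p)) (fst q)"
proof -
  let ?c = "chart_at M (fst q)"
  let ?W = "coord_field M ?c w"
  let ?D = "cdom ?c \<times> (UNIV :: real set)"
  have D: "open ?D" "q \<in> ?D" by (auto simp: mem_Times_iff intro!: open_Times)
  have sm: "smooth_vf M (cdom ?c) ?W" by (rule smooth_coord_field) simp
  have W: "smooth_vf N ?D (lift ?W)" by (rule smooth_vf_lift[OF _ sm]) simp
  have "g (fst q) (fst (K q)) w = G q (K q) (lift ?W q)"
    by (simp add: warped_metric_eq)
  also have "\<dots> = - f (fst q) * snd (nabla \<xi> (lift ?W) q)"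
    unfolding K_def
    by (subst metric_compat_const[OF D(1) smooth_reeb smooth_reeb W D(2), of 0]) (simp_all add: G_reeb)
  \<comment> \<open>Since \<open>nabla (lift ?W) \<xi>\<close> vanishes at \<open>q\<close>, torsion
    leaves only the derivative of the line component \<open>1/f\<close> of the Reeb field.\<close>
  also have "snd (nabla \<xi> (lift ?W) q) = - dir_deriv N (lift ?W) (\<lambda>q. inverse (f (fst q))) q"
    using torsion_snd[OF D(1) smooth_reeb W D(2)] nabla_lift_reeb[OF _ sm, of q]
    by (simp add: line.dir_deriv_const[OF D] warped_reeb_eq)
  also have "dir_deriv N (lift ?W) (\<lambda>q. inverse (f (fst q))) q
      = dir_deriv M (\<lambda>_. w) (\<lambda>p. inverse (f p)) (fst q)"
    by (subst dir_deriv_lift[OF open_UNIV smooth_inverse_f]) simp_all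
  finally show ?thesis by simp
qed

definition "K_base p = fst (K (p, 0))"

text \<open>The right side of \<open>g_K\<close> involves the base point but not \<open>t\<close>,
  so the difference of \<open>K\<close> at \<open>(p, t)\<close> and at \<open>(p, 0)\<close> is
  orthogonal to itself. The slice \<open>t = 0\<close> in \<open>K_base\<close> is an arbitrary
  choice.\<close>

lemma K_eq: "K = lift K_base"
proof
  fix q
  let ?v = "fst (K q) - K_base (fst q)"
  have "g (fst q) ?v ?v = 0"
    using g_K[of q ?v] g_K[of "(fst q, 0)" ?v] by (simp add: bilinear_lsub[OF g_bilinear] K_base_def)
  then have "?v = 0"
    using g_pos[of ?v "fst q"] by (metis less_irrefl)
  then show "K q = lift K_base q" by (simp add: prod_eq_iff)
qed

lemma smooth_K_base: "smooth_vf M UNIV K_base"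
  unfolding K_base_def by (rule smooth_vf_slice[OF smooth_K])

abbreviation "phi_K \<equiv> lift (\<lambda>p. J p (K_base p))"

lemma smooth_phi_K: "smooth_vf N U phi_K"
proof -
  have "smooth_vf N UNIV phi_K"
    using smooth_vf_lift[OF open_UNIV J_smooth[OF open_UNIV smooth_K_base]] by simp
  then show ?thesis by (rule smooth_vf_subset) simp
qed

lemma fst_nabla_reeb_phi_K: "fst (nabla \<xi> phi_K q) = 0"
  by (rule fst_nabla_reeb_lift[OF open_UNIV J_smooth[OF open_UNIV smooth_K_base]]) simp

lemma fst_nabla_reeb_K: "fst (nabla \<xi> K q) = 0"
  unfolding K_eq by (rule fst_nabla_reeb_lift[OF open_UNIV smooth_K_base]) simp

text \<open>As \<open>K\<close> is a lift, only a vertical part remains; differentiating the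
  orthogonality of \<open>K\<close> and the Reeb field determines it.\<close>

lemma nabla_reeb_K: "nabla \<xi> K q = - G q (K q) (K q) *\<^sub>R \<xi> q"
proof -
  have "G q (nabla \<xi> \<xi> q) (K q) = - G q (\<xi> q) (nabla \<xi> K q)"
    by (rule metric_compat_const[OF open_UNIV smooth_reeb smooth_reeb smooth_K, where k = 0])
      (simp_all add: G_reeb)
  then have "f (fst q) * snd (nabla \<xi> K q) = - G q (K q) (K q)"
    by (simp add: K_def[symmetric] G_reeb)
  then have "snd (nabla \<xi> K q) = - G q (K q) (K q) * inverse (f (fst q))"
    by (simp add: field_simps)
  then show ?thesis
    by (simp add: prod_eq_iff fst_nabla_reeb_K warped_reeb_eq)
qed

lemma proj_D_eq: "proj_D G \<xi> q v = (fst v, 0)"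
  by (simp add: proj_D_def G_reeb prod_eq_iff) (simp add: warped_reeb_eq)

section \<open>Traces over a local orthonormal frame\<close>

context
  fixes U :: "('m \<times> real) set" and E :: "nat \<Rightarrow> 'm \<times> real \<Rightarrow> 'e \<times> real"
  assumes frame: "orthonormal_frame N G U E"
begin

text \<open>By \<open>G_reeb\<close> this is the dual form of the Reeb field evaluated on
  \<open>E i\<close>, hence also the coefficient of \<open>E i\<close> in the Reeb field.\<close>

abbreviation "\<eta> i q \<equiv> f (fst q) * snd (E i q)"

lemma U_open: "open U"
  and E_smooth: "i \<in> {..<DIM('e \<times> real)} \<Longrightarrow> smooth_vf N U (E i)"
  using frame by (auto simp: orthonormal_frame_def)

lemma eta_smooth: "i \<in> {..<DIM('e \<times> real)} \<Longrightarrow> smooth_fun N U (\<eta> i)"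
  by (intro line.smooth_fun_mult smooth_f_lift smooth_fun_snd_field U_open E_smooth)

lemma reeb_expansion:
  assumes "q \<in> U"
  shows "(\<Sum>i<DIM('e \<times> real). \<eta> i q *\<^sub>R E i q) = \<xi> q"
proof -
  have "(\<Sum>i<DIM('e \<times> real). G q (E i q) (\<xi> q) *\<^sub>R E i q) = \<xi> q"
    by (rule orthonormal_expansion[OF G_bilinear]) (use frame assms in \<open>auto simp: orthonormal_frame_def\<close>)
  then show ?thesis by (simp only: G_reeb)
qed

lemma sum_eta_G:
  assumes "q \<in> U"
  shows "(\<Sum>i<DIM('e \<times> real). \<eta> i q * G q v (E i q)) = f (fst q) * snd v"
proof -
  have lin: "linear (G q v)" using G_bilinear[of q] unfolding bilinear_def by blast
  have "(\<Sum>i<DIM('e \<times> real). \<eta> i q * G q v (E i q)) = G q v (\<Sum>i<DIM('e \<times> real). \<eta> i q *\<^sub>R E i q)"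
    by (simp only: linear_sum[OF lin] linear_scale[OF lin] real_scaleR_def)
  then show ?thesis by (simp only: reeb_expansion[OF assms] G_reeb)
qed

text \<open>Linearity over functions in the direction slot moves the coefficients inside, where they
  sum to the Reeb field. This is what collapses the traces.\<close>

lemma sum_eta_nabla:
  assumes "q \<in> U" "smooth_vf N U Y"
  shows "(\<Sum>i<DIM('e \<times> real). \<eta> i q *\<^sub>R nabla (E i) Y q) = nabla \<xi> Y q"
proof -
  have "nabla \<xi> Y q = nabla (\<lambda>q. \<Sum>i<DIM('e \<times> real). \<eta> i q *\<^sub>R E i q) Y q"
    by (rule line.nabla_cong_left[OF U_open assms(1) smooth_reeb assms(2)]) (simp only: reeb_expansion)
  also have "\<dots> = (\<Sum>i<DIM('e \<times> real). \<eta> i q *\<^sub>R nabla (E i) Y q)"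
    by (rule line.nabla_sum_left[OF U_open assms eta_smooth E_smooth])
  finally show ?thesis by simp
qed

lemma nabla_nabla_reeb:
  assumes "q \<in> U" "i \<in> {..<DIM('e \<times> real)}"
  shows "nabla (E i) (nabla (E i) \<xi>) q = dir_deriv N (E i) (\<eta> i) q *\<^sub>R K q + \<eta> i q *\<^sub>R nabla (E i) K q"
proof -
  note Ei = E_smooth[OF assms(2)]
  have "nabla (E i) (nabla (E i) \<xi>) q = nabla (E i) (\<lambda>q. \<eta> i q *\<^sub>R K q) q"
    by (rule line.nabla_cong_right[OF U_open assms(1) Ei line.smooth_nabla[OF U_open Ei smooth_reeb]])
      (rule nabla_reeb[OF U_open Ei])
  also have "\<dots> = dir_deriv N (E i) (\<eta> i) q *\<^sub>R K q + \<eta> i q *\<^sub>R nabla (E i) K q"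
    by (rule line.nabla_scale_right[OF U_open eta_smooth[OF assms(2)] Ei smooth_K assms(1)])
  finally show ?thesis .
qed

lemma nabla2_reeb:
  assumes "q \<in> U" "i \<in> {..<DIM('e \<times> real)}"
  shows "nabla2 nabla (E i) (E i) \<xi> q = (\<eta> i q * G q (K q) (E i q)) *\<^sub>R K q + \<eta> i q *\<^sub>R nabla (E i) K q"
proof -
  note Ei = E_smooth[OF assms(2)]
  \<comment> \<open>\<open>\<eta> i\<close> is the inner product of the Reeb field with
    \<open>E i\<close>. Of the two terms given by metric compatibility, the second is exactly what
    the correction term in \<open>nabla2\<close> cancels.\<close>
  have "dir_deriv N (E i) (\<eta> i) q = G q (\<eta> i q *\<^sub>R K q) (E i q) + f (fst q) * snd (nabla (E i) (E i) q)"
    using metric_compat[OF U_open Ei smooth_reeb Ei assms(1)]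
    by (simp only: nabla_reeb[OF U_open Ei assms(1)] G_reeb)
  then show ?thesis
    unfolding nabla2_def nabla_nabla_reeb[OF assms]
      nabla_reeb[OF U_open line.smooth_nabla[OF U_open Ei Ei] assms(1)]
    by (simp add: bilinear_lmul[OF G_bilinear] algebra_simps)
qed

lemma tension_reeb:
  assumes "q \<in> U"
  shows "tension G nabla E \<xi> q = 0"
proof -
  have "(\<Sum>i<DIM('e \<times> real). nabla2 nabla (E i) (E i) \<xi> q)
      = (\<Sum>i<DIM('e \<times> real). \<eta> i q * G q (K q) (E i q)) *\<^sub>R K q + (\<Sum>i<DIM('e \<times> real). \<eta> i q *\<^sub>R nabla (E i) K q)"
    by (simp only: nabla2_reeb[OF assms] sum.distrib scaleR_sum_left cong: sum.cong)
  \<comment> \<open>The first sum is the inner product of \<open>K\<close> with the Reeb field,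
    which is zero because \<open>K\<close> is horizontal.\<close>
  also have "\<dots> = - G q (K q) (K q) *\<^sub>R \<xi> q"
    by (simp only: sum_eta_G[OF assms] sum_eta_nabla[OF assms smooth_K] nabla_reeb_K) simp
  finally have lap: "rough_laplacian nabla E \<xi> q = G q (K q) (K q) *\<^sub>R \<xi> q"
    by (simp add: rough_laplacian_def)
  \<comment> \<open>One of the two factors \<open>\<eta> i\<close> is written as
    \<open>G q (\<xi> q) (E i q)\<close>, so that \<open>sum_eta_G\<close> evaluates the sum of
    their squares to 1.\<close>
  have "norm2_nabla G nabla E \<xi> q = (\<Sum>i<DIM('e \<times> real). \<eta> i q * G q (\<xi> q) (E i q)) * G q (K q) (K q)"
    unfolding norm2_nabla_def sum_distrib_right
    by (rule sum.cong)
      (simp_all only: nabla_reeb[OF U_open E_smooth assms] bilinear_lmul[OF G_bilinear]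
        bilinear_rmul[OF G_bilinear] G_reeb real_scaleR_def mult.assoc)
  then have "norm2_nabla G nabla E \<xi> q = G q (K q) (K q)"
    by (simp only: sum_eta_G[OF assms]) (simp add: warped_reeb_eq)
  with lap show ?thesis by (simp add: tension_def)
qed

lemma T_field_reeb:
  assumes "q \<in> U"
  shows "T_field G (warped_phi J) \<xi> nabla E q = 0"
proof -
  have "nabla_bar_J G (warped_phi J) \<xi> nabla (E i) (nabla (E i) \<xi>) q
      = (fst (\<eta> i q *\<^sub>R nabla (E i) phi_K q) - J (fst q) (fst (\<eta> i q *\<^sub>R nabla (E i) K q)), 0)"
    if i: "i \<in> {..<DIM('e \<times> real)}" for i
  proof -
    note Ei = E_smooth[OF i]
    \<comment> \<open>On \<open>U\<close> the field \<open>nabla (E i) \<xi>\<close> is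
      \<open>\<eta> i\<close> times \<open>K\<close>, and the structure tensor commutes with the
      scalar factor.\<close>
    have "nabla (E i) (\<lambda>r. \<eta> i r *\<^sub>R phi_K r) q = nabla (E i) (\<lambda>r. warped_phi J r (nabla (E i) \<xi> r)) q"
      by (rule line.nabla_cong_right[OF U_open assms Ei
            line.smooth_vf_scale[OF U_open eta_smooth[OF i] smooth_phi_K]])
        (simp add: nabla_reeb[OF U_open Ei] warped_phi_eq K_eq linear_scale[OF J_linear])
    moreover have "nabla (E i) (\<lambda>r. \<eta> i r *\<^sub>R phi_K r) q
        = dir_deriv N (E i) (\<eta> i) q *\<^sub>R phi_K q + \<eta> i q *\<^sub>R nabla (E i) phi_K q"
      by (rule line.nabla_scale_right[OF U_open eta_smooth[OF i] Ei smooth_phi_K assms])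
    moreover have "fst (K q) = K_base (fst q)" by (simp add: K_eq)
    \<comment> \<open>The terms in which \<open>\<eta> i\<close> is differentiated cancel, both
      being that derivative times \<open>J\<close> applied to \<open>K\<close>.\<close>
    ultimately show ?thesis
      unfolding nabla_bar_J_def nabla_bar_def proj_D_eq warped_phi_eq nabla_nabla_reeb[OF assms i]
      by (simp add: linear_add[OF J_linear] linear_scale[OF J_linear])
  qed
  then have "T_field G (warped_phi J) \<xi> nabla E q
      = (\<Sum>i<DIM('e \<times> real). (fst (\<eta> i q *\<^sub>R nabla (E i) phi_K q) - J (fst q) (fst (\<eta> i q *\<^sub>R nabla (E i) K q)), 0))"
    unfolding T_field_def by (rule sum.cong[OF refl])
  \<comment> \<open>Linearity of \<open>J\<close> and of the projection brings the sums next to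
    \<open>nabla\<close>, where \<open>sum_eta_nabla\<close> turns them into derivatives along the
    Reeb field.\<close>
  also have "\<dots> = (fst (\<Sum>i<DIM('e \<times> real). \<eta> i q *\<^sub>R nabla (E i) phi_K q)
      - J (fst q) (fst (\<Sum>i<DIM('e \<times> real). \<eta> i q *\<^sub>R nabla (E i) K q)), 0)"
    by (simp only: prod_eq_iff fst_sum snd_sum fst_conv snd_conv sum_subtractf linear_sum[OF J_linear]) simp
  also have "\<dots> = 0"
    by (simp only: sum_eta_nabla[OF assms smooth_K] sum_eta_nabla[OF assms smooth_phi_K] fst_nabla_reeb_K
        fst_nabla_reeb_phi_K linear_0[OF J_linear]) (simp add: zero_prod_def)
  finally show ?thesis .
qed

end

end

theorem proposition3p1:
  fixes M :: "('m::{t2_space, second_countable_topology}, 'e::euclidean_space) manifold"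
    and g :: "'m \<Rightarrow> 'e \<Rightarrow> 'e \<Rightarrow> real"
    and J :: "'m \<Rightarrow> 'e \<Rightarrow> 'e"
    and f :: "'m \<Rightarrow> real"
    and n :: nat
    and nabla :: "('m \<times> real, 'e \<times> real) connection"
  assumes "DIM('e) = 2 * n"
    and "almost_hermitian M g J"
    and "smooth_fun M UNIV f"
    and "\<And>p. f p > 0"
    and "levi_civita (line_product M) (warped_metric g f) nabla"
  shows "harmonic_unit_field (line_product M) (warped_metric g f) nabla (warped_reeb f) \<and>
         first_harmonic_section_equation (line_product M) (warped_metric g f)
           (warped_phi J) (warped_reeb f) nabla"
proof -
  interpret warped_loc M g J f nabla
    by unfold_locales (use assms in \<open>simp_all add: almost_hermitian_def\<close>)
  have "unit_vector_field N G \<xi>"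
    by (simp add: unit_vector_field_def smooth_reeb G_reeb) (simp add: warped_reeb_eq)
  \<comment> \<open>The two summands of the section equation vanish separately.\<close>
  then show ?thesis
    by (simp add: harmonic_unit_field_def first_harmonic_section_equation_def tension_reeb T_field_reeb
        warped_phi_eq linear_0[OF J_linear] zero_prod_def)
qed

end
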